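(* Fix an integer $d\ge 3$ and $\varepsilon>0$. For $x\in(0,1)$ and $z$ with $0<z<1/2$ and $zx<(1-x)/2$, let $$g_d(x,z) = \left(\frac d2 - 1 - dz\right)x\log x + (d-1)(1-x)\log\left(\frac{1-x}{2}\right) - 2dxz\log z - \frac{(1-2z)dx}{2}\log(1-2z) - d\left(\frac{1-x}{2}-zx\right)\log\left(\frac{1-x}{2}-zx\right).$$ For each fixed $x\in(0,1)$, the function $z\mapsto g_d(x,z)$ is maximized at $$z_0(x)=\frac{1-\sqrt{1-2(1-x)x}}{2x}.$$ Let $h_d(x)=g_d(x,z_0(x))$, and let $x_d$ be the unique $x\in(0,1)$ with $h_d(x)=0$. Then asymptotically almost surely $H(\mathcal{G}_{n,d}) > (x_d-\varepsilon)n$.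
   Context: Hopping forcing: given a graph $G$ with each vertex coloured blue or white, the hopping forcing rule allows a blue vertex $b$ to force (recolour blue) a white vertex $w$ at distance exactly two from $b$, provided that every neighbour of $b$ is blue and $b$ has not previously performed a force (each vertex can perform at most one force). A set $B\subseteq V(G)$ is feasible if, starting with exactly the vertices of $B$ blue, repeated sequential applications of the rule can make all vertices blue. The hopping forcing number $H(G)$ is the minimum size of a feasible set. $\mathcal{G}_{n,d}$ is a uniformly random $d$-regular simple graph on $n$ labelled vertices ($dn$ even), $d$ fixed, $n\to\infty$; an event holds asymptotically almost surely (a.a.s.) if its probability tends to $1$ as $n\to\infty$. $\log$ denotes the natural logarithm. *)

theory Defs
  imports "HOL-Probability.Probability"
begin

section \<open>Simple graphs and distance\<close>

text \<open>A simple graph is given by a vertex set \<open>V\<close> and a set \<open>E\<close> of two-element subsets of \<open>V\<close>.\<close>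

definition simple_graph :: "'a set \<Rightarrow> 'a set set \<Rightarrow> bool" where
  "simple_graph V E \<longleftrightarrow> finite V \<and> (\<forall>e\<in>E. e \<subseteq> V \<and> card e = 2)"

definition neighbours :: "'a set set \<Rightarrow> 'a \<Rightarrow> 'a set" where
  "neighbours E v = {u. {u, v} \<in> E}"

definition walk :: "'a set \<Rightarrow> 'a set set \<Rightarrow> 'a list \<Rightarrow> bool" where
  "walk V E p \<longleftrightarrow> p \<noteq> [] \<and> set p \<subseteq> V \<and> successively (\<lambda>u v. {u, v} \<in> E) p"

text \<open>The distance is \<open>\<infinity>\<close> (the infimum of the empty set) for vertices in different components.\<close>

definition graph_dist :: "'a set \<Rightarrow> 'a set set \<Rightarrow> 'a \<Rightarrow> 'a \<Rightarrow> enat" where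
  "graph_dist V E u v =
     (INF p \<in> {p. walk V E p \<and> hd p = u \<and> last p = v}. enat (length p - 1))"


section \<open>Hopping forcing\<close>

text \<open>A state is a pair \<open>(S, F)\<close>: \<open>S\<close> is the set of blue vertices and \<open>F\<close> the set of vertices that
  have already performed a force.\<close>

inductive hop_step :: "'a set \<Rightarrow> 'a set set \<Rightarrow> 'a set \<times> 'a set \<Rightarrow> 'a set \<times> 'a set \<Rightarrow> bool"
  for V :: "'a set" and E :: "'a set set" where
  "\<lbrakk>b \<in> S; b \<notin> F; neighbours E b \<subseteq> S; w \<in> V - S; graph_dist V E b w = 2\<rbrakk>
    \<Longrightarrow> hop_step V E (S, F) (insert w S, insert b F)"

definition hop_feasible :: "'a set \<Rightarrow> 'a set set \<Rightarrow> 'a set \<Rightarrow> bool" where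
  "hop_feasible V E B \<longleftrightarrow> B \<subseteq> V \<and> (\<exists>F. (hop_step V E)\<^sup>*\<^sup>* (B, {}) (V, F))"

definition hopping_number :: "'a set \<Rightarrow> 'a set set \<Rightarrow> nat" where
  "hopping_number V E = (LEAST k. \<exists>B. hop_feasible V E B \<and> card B = k)"


section \<open>Random regular graphs\<close>

definition regular_graphs :: "nat \<Rightarrow> nat \<Rightarrow> nat set set set" where
  "regular_graphs n d =
     {E. simple_graph {..<n} E \<and> (\<forall>v\<in>{..<n}. card (neighbours E v) = d)}"

text \<open>For \<open>d * n\<close> even and \<open>n > d\<close> the set of regular graphs is nonempty, so this is the uniform
  distribution; for other \<open>n\<close> it is an unspecified distribution.\<close>

definition random_regular_graph :: "nat \<Rightarrow> nat \<Rightarrow> nat set set pmf" where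
  "random_regular_graph n d = pmf_of_set (regular_graphs n d)"

text \<open>The limit is taken along those \<open>n\<close> for which \<open>d * n\<close> is even.\<close>

definition aas_regular :: "nat \<Rightarrow> (nat \<Rightarrow> nat set set \<Rightarrow> bool) \<Rightarrow> bool" where
  "aas_regular d P \<longleftrightarrow>
     ((\<lambda>n. measure_pmf.prob (random_regular_graph n d) {E. P n E}) \<longlongrightarrow> 1)
       (inf sequentially (principal {n. even (d * n)}))"


section \<open>The rate function\<close>

definition g :: "nat \<Rightarrow> real \<Rightarrow> real \<Rightarrow> real" where
  "g d x z =
     (real d / 2 - 1 - real d * z) * x * ln x
     + (real d - 1) * (1 - x) * ln ((1 - x) / 2)
     - 2 * real d * x * z * ln z
     - ((1 - 2 * z) * real d * x / 2) * ln (1 - 2 * z)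
     - real d * ((1 - x) / 2 - z * x) * ln ((1 - x) / 2 - z * x)"

definition z0 :: "real \<Rightarrow> real" where
  "z0 x = (1 - sqrt (1 - 2 * (1 - x) * x)) / (2 * x)"

definition h :: "nat \<Rightarrow> real \<Rightarrow> real" where
  "h d x = g d x (z0 x)"

definition x_root :: "nat \<Rightarrow> real" where
  "x_root d = (THE x. 0 < x \<and> x < 1 \<and> h d x = 0)"

end

theory Submission
  imports Defs "HOL-Real_Asymp.Real_Asymp" "HOL-Combinatorics.Multiset_Permutations"
begin

text \<open>If \<open>B\<close> is feasible with \<open>|B| + 2s \<le> n\<close>, then after \<open>s\<close> forces the \<open>s\<close> forcing vertices have only blue
  neighbours while \<open>s\<close> vertices are still white; this yields disjoint sets \<open>A\<close>, \<open>C\<close> of size \<open>s\<close> without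
  an edge between them. The theorem is a first moment bound for such pairs.

  A \<open>d\<close>-regular graph is encoded by words in which every vertex occurs \<open>d\<close> times and consecutive letters
  are paired into edges; every simple graph has the same number of encodings. Swapping two letters
  shows that a uniform word has boundedly many defects (loops, multiple edges) on average, and that a
  defect can be removed by one swap, so simple words make up at least a polynomially small fraction.
  Words avoiding edges between \<open>A\<close> and \<open>C\<close> are counted by giving the letters of \<open>A \<union> C\<close> weight \<open>u\<close> and the
  others weight \<open>w\<close>, with \<open>2u\<^sup>2 + 4uw + w\<^sup>2 = 1\<close>; the best choice of \<open>t = u / w\<close> gives the exponent \<open>h d x\<close>.

  In the parameter \<open>t\<close> one has \<open>x = (1 + 2t) / (1 + 4t + 2t\<^sup>2)\<close>, and the derivative of \<open>h d\<close> with respect to \<open>x\<close> is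
  \<open>ln t + (d - 1) ln ((1 + 2t) / (1 + t))\<close>, which is increasing in \<open>t\<close>; hence \<open>h d\<close> is concave, and its values
  at the two ends of the unit interval determine its sign.\<close>

section \<open>Analysis of the rate function\<close>

definition den :: "real \<Rightarrow> real" where
  "den t = 1 + 4 * t + 2 * t\<^sup>2"

text \<open>The expected proportion of letters of weight \<open>w\<close> in a random pair drawn
  with the weights of \<open>card_avoiding_words\<close> when \<open>u = t * w\<close>;
  \<open>den t\<close> is the normalising factor.\<close>

definition xpar :: "real \<Rightarrow> real" where
  "xpar t = (1 + 2 * t) / den t"

text \<open>This is \<open>h d\<close> at \<open>xpar t\<close>, by \<open>h_xpar\<close>. The first
  line is the entropy of the class sizes, the second the contribution of the weights
  \<open>w = 1 / sqrt (den t)\<close> and \<open>u = t * w\<close>.\<close>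

definition rate :: "nat \<Rightarrow> real \<Rightarrow> real" where
  "rate d t = (real d - 1) * (xpar t * ln (xpar t) + (1 - xpar t) * ln ((1 - xpar t) / 2))
     - real d * ((1 - xpar t) * ln t - ln (den t) / 2)"

lemma den_pos: "t > 0 \<Longrightarrow> den t > 0"
  by (simp add: den_def add_pos_pos)

lemma one_minus_xpar: "t > 0 \<Longrightarrow> 1 - xpar t = 2 * (t * (1 + t)) / den t"
  using den_pos[of t] by (simp add: xpar_def field_simps) (simp add: den_def power2_eq_square algebra_simps)

lemma xpar_bounds: assumes "t > 0" shows "0 < xpar t" "xpar t < 1"
proof -
  show "0 < xpar t" using assms den_pos[OF assms] by (simp add: xpar_def)
  have "0 < 1 - xpar t" unfolding one_minus_xpar[OF assms] using assms den_pos[OF assms] by simp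
  then show "xpar t < 1" by simp
qed

text \<open>The parameter rationalises the square root in \<open>z0\<close>: the radicand becomes
  the square of \<open>(1 + 2 * t + 2 * t\<^sup>2) / den t\<close>.\<close>

lemma z0_xpar: assumes "t > 0" shows "z0 (xpar t) = t / (1 + 2 * t)"
proof -
  have D: "den t > 0" using den_pos[OF assms] .
  have "1 - 2 * (1 - xpar t) * xpar t = ((1 + 2 * t + 2 * t\<^sup>2) / den t)\<^sup>2"
    unfolding one_minus_xpar[OF assms] unfolding xpar_def using D
    by (simp add: field_simps power2_eq_square) (simp add: den_def power2_eq_square algebra_simps)
  then have "sqrt (1 - 2 * (1 - xpar t) * xpar t) = (1 + 2 * t + 2 * t\<^sup>2) / den t"
    using D assms by (simp add: real_sqrt_abs add_nonneg_nonneg)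
  moreover have "1 - (1 + 2 * t + 2 * t\<^sup>2) / den t = 2 * t / den t"
    using D by (simp add: field_simps) (simp add: den_def algebra_simps)
  ultimately have "z0 (xpar t) = (2 * t / den t) / (2 * xpar t)" by (simp add: z0_def)
  then show ?thesis using D assms by (simp add: xpar_def field_simps)
qed

text \<open>The equation \<open>x * den t = 1 + 2 * t\<close> is a quadratic in \<open>t\<close>
  whose roots have opposite signs; the positive root is taken.\<close>

lemma xpar_surj: assumes "0 < x" "x < 1" obtains t where "t > 0" "xpar t = x"
proof -
  define r where "r = sqrt ((4*x-2)\<^sup>2 + 8*x*(1-x))"
  define t where "t = (r - (4*x-2)) / (4*x)"
  have "8*x*(1-x) > 0" using assms by simp
  then have "\<bar>4*x-2\<bar> < r" unfolding r_def by (intro real_less_rsqrt) simp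
  then have t: "t > 0" using assms by (auto simp: t_def)
  have r2: "r\<^sup>2 = (4*x-2)\<^sup>2 + 8*x*(1-x)" unfolding r_def using assms by simp
  have "4*x*t = r - (4*x-2)" using assms by (simp add: t_def)
  then have "(4*x*t + (4*x-2))\<^sup>2 = (4*x-2)\<^sup>2 + 8*x*(1-x)" using r2 by simp
  then have "8 * x * (2*x*t\<^sup>2 + (4*x-2)*t) = 8 * x * (1-x)" by (simp add: power2_eq_square algebra_simps)
  then have "2*x*t\<^sup>2 + (4*x-2)*t = 1-x" using assms by simp
  then have "x * den t = 1 + 2*t" by (simp add: den_def algebra_simps)
  then have "xpar t = x" using den_pos[OF t] by (simp add: xpar_def field_simps)
  with t that show thesis by blast
qed

text \<open>In terms of \<open>e = z * x\<close>, the variable part is a negative entropy of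
  \<open>e\<close>, \<open>x - 2 * e\<close> and \<open>(1 - x) / 2 - e\<close>, the proportions of
  mixed pairs, of pairs outside the two cut sets and of pairs inside one cut set. The multiplicities
  4, 1, 2 count the ordered type pairs of each kind, so the total is 1.\<close>

lemma g_alt:
  assumes "0 < x" "0 < z" "z < 1/2"
  shows "g d x z = (real d - 1) * (x * ln x + (1 - x) * ln ((1 - x) / 2))
    - real d / 2 * (4 * (z*x) * ln (z*x) + (x - 2*(z*x)) * ln (x - 2*(z*x))
       + 2 * ((1-x)/2 - z*x) * ln ((1-x)/2 - z*x))"
proof -
  have "x - 2*(z*x) = x * (1 - 2*z)" by (simp add: algebra_simps)
  then have "ln (x - 2*(z*x)) = ln x + ln (1 - 2*z)" using assms by (simp add: ln_mult)
  moreover have "ln (z*x) = ln z + ln x" using assms by (simp add: ln_mult)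
  ultimately show ?thesis unfolding g_def by (simp add: field_simps)
qed

text \<open>Convexity of \<open>y * ln y\<close>: the right-hand side is its tangent at
  \<open>c\<close>.\<close>

lemma xlnx_tangent:
  fixes y c :: real assumes "y > 0" "c > 0" shows "y * ln y \<ge> y * ln c + y - c"
proof -
  have "ln (c / y) \<le> c / y - 1" using assms by (intro ln_le_minus_one) simp
  then have "y * (ln c - ln y) \<le> y * (c / y - 1)" using assms by (intro mult_left_mono) (auto simp: ln_div)
  then show ?thesis using assms by (simp add: algebra_simps)
qed

text \<open>Gibbs' inequality for the pair proportions against \<open>t / den t\<close>,
  \<open>1 / den t\<close> and \<open>t\<^sup>2 / den t\<close>, which are the proportions at
  \<open>z = z0 (xpar t)\<close>.\<close>

lemma
  assumes t: "t > 0"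
  shows h_xpar: "h d (xpar t) = rate d t"
    and z0_feasible: "0 < z0 (xpar t)" "z0 (xpar t) < 1/2" "z0 (xpar t) * xpar t < (1 - xpar t) / 2"
    and g_le_rate: "\<And>z. 0 < z \<Longrightarrow> z < 1/2 \<Longrightarrow> z * xpar t < (1 - xpar t) / 2 \<Longrightarrow> g d (xpar t) z \<le> rate d t"
proof -
  note D = den_pos[OF t] and x = xpar_bounds[OF t]
  show z: "0 < z0 (xpar t)" "z0 (xpar t) < 1/2" using t by (auto simp: z0_xpar)
  have e0: "z0 (xpar t) * xpar t = t / den t" using t D by (simp only: z0_xpar) (simp add: xpar_def)
  have p0: "(1 - xpar t) / 2 - t / den t = t\<^sup>2 / den t" using D
    by (simp add: one_minus_xpar[OF t] field_simps power2_eq_square)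
  have q0: "xpar t - 2 * (t / den t) = 1 / den t" using D by (simp add: xpar_def field_simps)
  have "t\<^sup>2 / den t > 0" using t D by simp
  then show "z0 (xpar t) * xpar t < (1 - xpar t) / 2" using p0 unfolding e0 by linarith
  have lns: "ln (t / den t) = ln t - ln (den t)" "ln (1 / den t) = - ln (den t)"
    "ln (t\<^sup>2 / den t) = 2 * ln t - ln (den t)"
    using t D by (simp_all add: ln_div ln_realpow)
  \<comment> \<open>The coefficient of \<open>e\<close> vanishes since
    \<open>ln (1 / den t) + ln (t\<^sup>2 / den t) = 2 * ln (t / den t)\<close>. Hence the cross
    entropy depends on \<open>x\<close> only and equals the entropy at \<open>z0\<close>.\<close>
  have cross: "4 * e * ln (t / den t) + q * ln (1 / den t) + 2 * p * ln (t\<^sup>2 / den t)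
     = 2 * (1 - xpar t) * ln t - ln (den t)"
    if "q = xpar t - 2 * e" "p = (1 - xpar t) / 2 - e" for e p q
    unfolding lns that by (simp add: field_simps)
  show "h d (xpar t) = rate d t"
    unfolding h_def g_alt[OF x(1) z] e0 rate_def p0 q0 cross[OF q0[symmetric] p0[symmetric]]
    by (simp add: algebra_simps diff_divide_distrib)
  fix z assume z': "0 < z" "z < 1/2" "z * xpar t < (1 - xpar t) / 2"
  define e where "e = z * xpar t"
  define q where "q = xpar t - 2 * e"
  define p where "p = (1 - xpar t) / 2 - e"
  have "q = xpar t * (1 - 2 * z)" by (simp add: q_def e_def algebra_simps)
  then have pos: "e > 0" "q > 0" "p > 0" using z' x by (auto simp: e_def p_def)
  have s1: "4 * e + q + 2 * p = 1" by (simp add: p_def q_def field_simps)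
  have s2: "4 * (t / den t) + 1 / den t + 2 * (t\<^sup>2 / den t) = 1"
    using D by (simp add: field_simps) (simp add: den_def algebra_simps)
  \<comment> \<open>The linear terms of the three tangent inequalities cancel because both weighted
    sums are 1.\<close>
  have "4 * e * ln e + q * ln q + 2 * p * ln p
      \<ge> 4 * e * ln (t / den t) + q * ln (1 / den t) + 2 * p * ln (t\<^sup>2 / den t)"
    using xlnx_tangent[OF pos(1), of "t / den t"] xlnx_tangent[OF pos(2), of "1 / den t"]
      xlnx_tangent[OF pos(3), of "t\<^sup>2 / den t"] t D s1 s2 by simp
  then have "4 * e * ln e + q * ln q + 2 * p * ln p \<ge> 2 * (1 - xpar t) * ln t - ln (den t)"
    by (subst (asm) cross) (simp_all add: q_def p_def)
  then have "real d / 2 * (4 * e * ln e + q * ln q + 2 * p * ln p)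
      \<ge> real d / 2 * (2 * (1 - xpar t) * ln t - ln (den t))"
    by (intro mult_left_mono) auto
  then show "g d (xpar t) z \<le> rate d t"
    unfolding g_alt[OF x(1) z'(1,2)] rate_def e_def[symmetric] q_def[symmetric] p_def[symmetric]
    by (simp add: field_simps)
qed

lemma is_arg_max_z0:
  assumes "0 < x" "x < 1"
  shows "is_arg_max (g d x) (\<lambda>z. 0 < z \<and> z < 1 / 2 \<and> z * x < (1 - x) / 2) (z0 x)"
proof -
  obtain t where t: "t > 0" "xpar t = x" using xpar_surj[OF assms] .
  show ?thesis using h_xpar[OF t(1), of d] z0_feasible[OF t(1)] g_le_rate[OF t(1), of _ d]
    unfolding is_arg_max_def t(2) h_def by force
qed

section \<open>Derivative, limits and sign of the rate function\<close>

lemma rate_alt: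
  assumes t: "t > 0"
  shows "rate d t = (real d - 1) * (xpar t * ln (1 + 2 * t) + (1 - xpar t) * ln (1 + t))
     - (real d / 2 - 1) * ln (den t) - (1 - xpar t) * ln t"
proof -
  note D = den_pos[OF t] and x = xpar_bounds[OF t]
  have 1: "ln (xpar t) = ln (1 + 2 * t) - ln (den t)"
    unfolding xpar_def using t D by (simp add: ln_div)
  have 2: "ln ((1 - xpar t) / 2) = ln t + ln (1 + t) - ln (den t)"
    unfolding one_minus_xpar[OF t] using t D by (simp add: ln_div ln_mult)
  show ?thesis unfolding rate_def 1 2 by (simp add: field_simps)
qed

definition slope :: "nat \<Rightarrow> real \<Rightarrow> real" where
  "slope d t = ln t + (real d - 1) * (ln (1 + 2 * t) - ln (1 + t))"

lemma xpar_deriv: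
  assumes t: "t > 0"
  shows "(xpar has_real_derivative - (2 + 4 * t + 4 * t\<^sup>2) / (den t)\<^sup>2) (at t)"
proof -
  have D: "1 + 4 * t + 2 * t\<^sup>2 \<noteq> 0" using den_pos[OF t] by (simp add: den_def)
  have "((\<lambda>t. (1 + 2 * t) / (1 + 4 * t + 2 * t\<^sup>2)) has_real_derivative
     - (2 + 4 * t + 4 * t\<^sup>2) / (1 + 4 * t + 2 * t\<^sup>2)\<^sup>2) (at t)"
    using D by (auto intro!: derivative_eq_intros simp: power2_eq_square divide_simps) (simp add: algebra_simps)
  then show ?thesis by (simp add: xpar_def[abs_def] den_def)
qed

lemma xpar_deriv_neg:
  assumes "t > 0" shows "- (2 + 4 * t + 4 * t\<^sup>2) / (den t)\<^sup>2 < 0"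
proof -
  have "2 + 4 * t + 4 * t\<^sup>2 > 0" using assms by (simp add: add_pos_nonneg)
  then show ?thesis using den_pos[OF assms] by (intro divide_neg_pos) auto
qed

text \<open>By the product rule, the terms that differentiate \<open>xpar\<close> collect to
  \<open>slope d t\<close> times its derivative, and those that differentiate logarithms cancel,
  which is fact \<open>c\<close>.\<close>

lemma rate_deriv:
  assumes t: "t > 0"
  shows "(rate d has_real_derivative slope d t * (- (2 + 4 * t + 4 * t\<^sup>2) / (den t)\<^sup>2)) (at t)"
proof -
  note D = den_pos[OF t]
  define X' where "X' = - (2 + 4 * t + 4 * t\<^sup>2) / (den t)\<^sup>2"
  have dd: "(den has_real_derivative 4 + 4 * t) (at t)"
    unfolding den_def[abs_def] by (auto intro!: derivative_eq_intros)
  have c: "(real d - 1) * (xpar t * (2 / (1 + 2 * t)) + (1 - xpar t) * (1 / (1 + t)))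
     - (real d / 2 - 1) * ((4 + 4 * t) / den t) - (1 - xpar t) * (1 / t) = 0"
  proof -
    have a: "xpar t * (2 / (1 + 2 * t)) = 2 / den t"
    proof -
      have ne: "1 + 2 * t \<noteq> 0" using t by simp
      show ?thesis unfolding xpar_def times_divide_times_eq mult.commute[of "den t"]
        by (rule mult_divide_mult_cancel_left[OF ne])
    qed
    have b: "(1 - xpar t) * (1 / (1 + t)) = 2 * t / den t" using t by (simp add: one_minus_xpar)
    have c: "(1 - xpar t) * (1 / t) = 2 * (1 + t) / den t" using t by (simp add: one_minus_xpar)
    show ?thesis unfolding a b c using D by (simp add: field_simps)
  qed
  have dl: "((\<lambda>t. ln (den t)) has_real_derivative (4 + 4 * t) / den t) (at t)"
    using DERIV_chain2[OF DERIV_ln[OF D] dd] by (simp add: field_simps)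
  have "((\<lambda>t. (real d - 1) * (xpar t * ln (1 + 2 * t) + (1 - xpar t) * ln (1 + t))
     - (real d / 2 - 1) * ln (den t) - (1 - xpar t) * ln t) has_real_derivative 
      (real d - 1) * ((X' * ln (1 + 2 * t) + (2 / (1 + 2 * t)) * xpar t)
         + ((0 - X') * ln (1 + t) + (1 / (1 + t)) * (1 - xpar t)))
      - (real d / 2 - 1) * ((4 + 4 * t) / den t) - ((0 - X') * ln t + (1 / t) * (1 - xpar t))) (at t)"
    using t by (intro derivative_intros DERIV_cmult DERIV_diff DERIV_add DERIV_mult dl)
       (auto intro!: derivative_eq_intros xpar_deriv[OF t, folded X'_def])
  also have "(real d - 1) * ((X' * ln (1 + 2 * t) + (2 / (1 + 2 * t)) * xpar t)
         + ((0 - X') * ln (1 + t) + (1 / (1 + t)) * (1 - xpar t)))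
      - (real d / 2 - 1) * ((4 + 4 * t) / den t) - ((0 - X') * ln t + (1 / t) * (1 - xpar t))
      = slope d t * X' + ((real d - 1) * (xpar t * (2 / (1 + 2 * t)) + (1 - xpar t) * (1 / (1 + t)))
     - (real d / 2 - 1) * ((4 + 4 * t) / den t) - (1 - xpar t) * (1 / t))"
    by (simp add: slope_def algebra_simps)
  finally have "((\<lambda>t. (real d - 1) * (xpar t * ln (1 + 2 * t) + (1 - xpar t) * ln (1 + t))
     - (real d / 2 - 1) * ln (den t) - (1 - xpar t) * ln t) has_real_derivative slope d t * X') (at t)"
    unfolding c by simp
  moreover have "eventually (\<lambda>t. t > (0::real)) (nhds t)"
    using t by (intro eventually_nhds_in_open[of "{0<..}", simplified]) auto
  ultimately show ?thesis unfolding X'_def[symmetric]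
    by (subst DERIV_cong_ev[OF refl _ refl]) (auto elim!: eventually_mono simp: rate_alt)
qed

lemma tendsto_rate_0: "(rate d \<longlongrightarrow> 0) (at_right 0)"
proof -
  have 1: "((\<lambda>t. xpar t * ln (1 + 2 * t) + (1 - xpar t) * ln (1 + t)) \<longlongrightarrow> 0) (at_right 0)"
    unfolding xpar_def den_def by real_asymp
  have 2: "((\<lambda>t. ln (den t)) \<longlongrightarrow> 0) (at_right 0)"
    unfolding den_def by real_asymp
  have 3: "((\<lambda>t. (1 - xpar t) * ln t) \<longlongrightarrow> 0) (at_right 0)"
    unfolding xpar_def den_def by real_asymp
  have "((\<lambda>t. (real d - 1) * (xpar t * ln (1 + 2 * t) + (1 - xpar t) * ln (1 + t))
     - (real d / 2 - 1) * ln (den t) - (1 - xpar t) * ln t) \<longlongrightarrow> (real d - 1) * 0 - (real d / 2 - 1) * 0 - 0) (at_right 0)"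
    by (intro tendsto_intros 1 2 3)
  moreover have "eventually (\<lambda>t. (real d - 1) * (xpar t * ln (1 + 2 * t) + (1 - xpar t) * ln (1 + t))
     - (real d / 2 - 1) * ln (den t) - (1 - xpar t) * ln t = rate d t) (at_right 0)"
    using eventually_at_right_less[of 0] by eventually_elim (simp add: rate_alt)
  ultimately show ?thesis by (rule Lim_transform_eventually[THEN tendsto_eq_rhs]) simp
qed

text \<open>This is the end \<open>x = 0\<close>. Since \<open>ln (den t)\<close> and
  \<open>ln t\<close> diverge, the terms of \<open>rate_alt\<close> are first regrouped into
  convergent ones; the multiples of \<open>ln t\<close> cancel.\<close>

lemma tendsto_rate_top: "(rate d \<longlongrightarrow> - (real d / 2 - 1) * ln 2) at_top"
proof -
  have 1: "((\<lambda>t. xpar t * (ln (1 + 2 * t) - ln (1 + t)) + (ln (1 + t) - ln t)) \<longlongrightarrow> 0) at_top"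
    unfolding xpar_def den_def by real_asymp
  have 2: "((\<lambda>t. ln (den t) - 2 * ln t) \<longlongrightarrow> ln 2) at_top"
    unfolding den_def by real_asymp
  have 3: "((\<lambda>t. xpar t * ln t) \<longlongrightarrow> 0) at_top"
    unfolding xpar_def den_def by real_asymp
  have "((\<lambda>t. (real d - 1) * (xpar t * (ln (1 + 2 * t) - ln (1 + t)) + (ln (1 + t) - ln t))
     - (real d / 2 - 1) * (ln (den t) - 2 * ln t) + xpar t * ln t) \<longlongrightarrow> (real d - 1) * 0 - (real d / 2 - 1) * ln 2 + 0) at_top"
    by (intro tendsto_intros 1 2 3)
  moreover have "eventually (\<lambda>t. (real d - 1) * (xpar t * (ln (1 + 2 * t) - ln (1 + t)) + (ln (1 + t) - ln t))
     - (real d / 2 - 1) * (ln (den t) - 2 * ln t) + xpar t * ln t = rate d t) at_top"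
    using eventually_gt_at_top[of 0] by eventually_elim (simp add: rate_alt algebra_simps)
  ultimately show ?thesis by (rule Lim_transform_eventually[THEN tendsto_eq_rhs]) (simp add: algebra_simps)
qed

lemma slope_strict_mono:
  assumes "d \<ge> 1" "0 < s" "s < t" shows "slope d s < slope d t"
proof -
  have "(1 + 2 * s) / (1 + s) \<le> (1 + 2 * t) / (1 + t)" using assms by (simp add: field_simps)
  then have "ln ((1 + 2 * s) / (1 + s)) \<le> ln ((1 + 2 * t) / (1 + t))" using assms by (subst ln_le_cancel_iff) auto
  then have "ln (1 + 2 * s) - ln (1 + s) \<le> ln (1 + 2 * t) - ln (1 + t)" using assms by (simp add: ln_div)
  then have "(real d - 1) * (ln (1 + 2 * s) - ln (1 + s)) \<le> (real d - 1) * (ln (1 + 2 * t) - ln (1 + t))"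
    using assms by (intro mult_left_mono) auto
  moreover have "ln s < ln t" using assms by simp
  ultimately show ?thesis unfolding slope_def by linarith
qed

lemma slope_root:
  assumes "d \<ge> 1" obtains t where "t > 0" "slope d t = 0"
proof -
  \<comment> \<open>Here \<open>ln s = - real d * ln 2\<close> outweighs the other summand of
    \<open>slope\<close>, which is at most \<open>(real d - 1) * ln 2\<close>.\<close>
  define s :: real where "s = 1 / 2 ^ d"
  have s: "s > 0" "s \<le> 1" by (auto simp: s_def)
  have "ln ((1 + 2 * s) / (1 + s)) \<le> ln 2" using s by (subst ln_le_cancel_iff) (auto simp: field_simps)
  then have l: "ln (1 + 2 * s) - ln (1 + s) \<le> ln 2" using s by (simp add: ln_div)
  have "ln s = - real d * ln 2" by (simp add: s_def ln_div ln_realpow)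
  moreover have "(real d - 1) * (ln (1 + 2 * s) - ln (1 + s)) \<le> (real d - 1) * ln 2"
    using assms l by (intro mult_left_mono) auto
  moreover have "ln (2::real) > 0" by simp
  ultimately have 1: "slope d s \<le> 0" unfolding slope_def left_diff_distrib[of _ _ "ln 2"] by linarith
  have 2: "slope d 1 \<ge> 0" using assms unfolding slope_def by simp
  have "continuous_on {s..1} (slope d)" unfolding slope_def using s by (intro continuous_intros) auto
  from IVT'[OF 1 2 s(2) this] obtain t where "s \<le> t" "slope d t = 0" by auto
  with s show thesis using that[of t] by auto
qed

lemma xpar_strict_antimono: assumes "0 < s" "s < t" shows "xpar t < xpar s"
proof (rule DERIV_neg_imp_decreasing[OF assms(2)])
  fix y assume "s \<le> y" "y \<le> t"
  then have y: "y > 0" using assms by simp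
  have "- (2 + 4 * y + 4 * y\<^sup>2) / (den y)\<^sup>2 < 0" by (rule xpar_deriv_neg[OF y])
  with xpar_deriv[OF y] show "\<exists>z. DERIV xpar y :> z \<and> z < 0" by blast
qed

text \<open>The function rises from its limit 0 at \<open>t = 0\<close> up to the zero
  \<open>c\<close> of \<open>slope\<close> and then falls to a negative limit, so it changes sign
  exactly once. Its monotonicity is opposite to the sign of \<open>slope\<close> because
  \<open>xpar\<close> decreases.\<close>

lemma rate_sign:
  assumes d: "d \<ge> 3"
  obtains t1 where "t1 > 0" "rate d t1 = 0" "\<forall>t>t1. rate d t < 0" "\<forall>t. 0 < t \<and> t < t1 \<longrightarrow> rate d t > 0"
proof -
  obtain c where c: "c > 0" "slope d c = 0" using slope_root[of d] d by auto
  have dneg: "- (2 + 4 * y + 4 * y\<^sup>2) / (den y)\<^sup>2 < 0" if "y > 0" for y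
    by (rule xpar_deriv_neg[OF that])
  have cont: "continuous_on {a..b} (rate d)" if "a > 0" for a b
  proof (intro continuous_at_imp_continuous_on ballI)
    fix y assume "y \<in> {a..b}"
    then have "y > 0" using that by simp
    then show "isCont (rate d) y" by (rule DERIV_isCont[OF rate_deriv])
  qed
  have inc: "rate d s < rate d t" if "0 < s" "s < t" "t \<le> c" for s t
  proof (rule DERIV_pos_imp_increasing_open[OF that(2)])
    fix y assume y: "s < y" "y < t"
    then have "slope d y < 0" using slope_strict_mono[of d y c] that c d by auto
    then have "slope d y * (- (2 + 4 * y + 4 * y\<^sup>2) / (den y)\<^sup>2) > 0"
      using dneg[of y] y that by (intro mult_neg_neg) auto
    then show "\<exists>z. DERIV (rate d) y :> z \<and> z > 0" using rate_deriv[of y d] y that by fastforce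
  qed (use cont that in auto)
  have dec: "rate d t < rate d s" if "c \<le> s" "s < t" for s t
  proof (rule DERIV_neg_imp_decreasing_open[OF that(2)])
    fix y assume y: "s < y" "y < t"
    then have "slope d y > 0" using slope_strict_mono[of d c y] that c d by auto
    then have "slope d y * (- (2 + 4 * y + 4 * y\<^sup>2) / (den y)\<^sup>2) < 0"
      using dneg[of y] y that c by (intro mult_pos_neg) auto
    then show "\<exists>z. DERIV (rate d) y :> z \<and> z < 0" using rate_deriv[of y d] y that c by fastforce
  qed (use cont that c in auto)
  have nonneg: "rate d s \<ge> 0" if "0 < s" "s \<le> c" for s
  proof (rule tendsto_upperbound[OF tendsto_rate_0])
    show "\<forall>\<^sub>F y in at_right 0. rate d y \<le> rate d s"
      using inc that by (auto simp: eventually_at_right_field intro!: exI[of _ s] less_imp_le)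
  qed simp
  \<comment> \<open>Strictness comes from comparing with the point \<open>s/2\<close>, where the
    limit gives only a weak inequality.\<close>
  have pos: "rate d s > 0" if "0 < s" "s \<le> c" for s
    using nonneg[of "s/2"] inc[of "s/2" s] that by auto
  have "- (real d / 2 - 1) * ln 2 < (0::real)" using d by (simp add: field_simps)
  from order_tendstoD(2)[OF tendsto_rate_top this]
  have "\<forall>\<^sub>F t in at_top. rate d t < 0" .
  then have ev: "\<forall>\<^sub>F t in at_top. rate d t < 0 \<and> t > c"
    using eventually_gt_at_top[of c] by eventually_elim simp
  obtain T where T: "rate d T < 0" "T > c"
    using eventually_happens'[OF trivial_limit_at_top_linorder ev] by blast
  have "rate d c \<ge> 0" using pos[of c] c by simp
  then obtain t1 where t1: "c \<le> t1" "t1 \<le> T" "rate d t1 = 0"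
    using IVT2'[OF less_imp_le[OF T(1)] _ less_imp_le[OF T(2)] cont[OF c(1)]] by blast
  have "t1 \<noteq> c" using t1(3) pos[of c] c by auto
  then have "c < t1" using t1 by simp
  have neg: "rate d t < 0" if "t1 < t" for t using dec[OF t1(1) that] t1(3) by simp
  have pos': "rate d t > 0" if "0 < t" "t < t1" for t
  proof (cases "t \<le> c")
    case True then show ?thesis using pos that by simp
  next
    case False then show ?thesis using dec[of t t1] that t1(3) by simp
  qed
  have "t1 > 0" using \<open>c < t1\<close> c(1) by simp
  then show thesis using t1(3) neg pos' by (intro that[of t1]) blast+
qed

text \<open>As \<open>xpar\<close> is a decreasing bijection onto the unit interval, the sign
  pattern in \<open>t\<close> transfers to \<open>x\<close> with the order reversed.\<close>

lemma h_root_unique: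
  assumes "d \<ge> 3"
  shows "\<exists>!x. 0 < x \<and> x < 1 \<and> h d x = 0"
    and "0 < x_root d" "x_root d < 1"
    and "\<And>t. t > 0 \<Longrightarrow> xpar t < x_root d \<Longrightarrow> rate d t < 0"
proof -
  obtain t1 where t1: "t1 > 0" "rate d t1 = 0" "\<forall>t>t1. rate d t < 0"
    "\<forall>t. 0 < t \<and> t < t1 \<longrightarrow> rate d t > 0" by (rule rate_sign[OF assms])
  have ex: "0 < xpar t1 \<and> xpar t1 < 1 \<and> h d (xpar t1) = 0" using xpar_bounds t1 h_xpar by auto
  have un: "x = xpar t1" if x: "0 < x" "x < 1" "h d x = 0" for x
  proof -
    obtain t where t: "t > 0" "xpar t = x" by (rule xpar_surj[OF x(1,2)])
    then have "rate d t = 0" using x(3) h_xpar[of t d] by simp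
    then have "t = t1" using t1(3,4) t(1) by (metis less_irrefl linorder_less_linear)
    then show ?thesis using t by simp
  qed
  show "\<exists>!x. 0 < x \<and> x < 1 \<and> h d x = 0" using ex un by blast
  have root: "x_root d = xpar t1" unfolding x_root_def using ex un by (intro the_equality) blast+
  then show "0 < x_root d" "x_root d < 1" using ex by auto
  fix t assume "t > 0" "xpar t < x_root d"
  then have "t > t1" using xpar_strict_antimono[of t t1] root t1(1) by (cases t t1 rule: linorder_cases) auto
  then show "rate d t < 0" using t1(3) by simp
qed

section \<open>Cuts and words\<close>

lemma hop_reach_invariant:
  assumes "(hop_step V E)\<^sup>*\<^sup>* (B, {}) (S, F)" "B \<subseteq> V" "finite V"
  shows "F \<subseteq> S \<and> S \<subseteq> V \<and> card S = card B + card F \<and> (\<forall>b\<in>F. neighbours E b \<subseteq> S)"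
  using assms(1)
proof (induction "(S, F)" arbitrary: S F rule: rtranclp_induct)
  case base
  then show ?case using assms by simp
next
  case (step y)
  obtain S' F' where y: "y = (S', F')" by fastforce
  note IH = step(3)[OF y]
  from step(2)[unfolded y] obtain b w where st: "b \<in> S'" "b \<notin> F'" "neighbours E b \<subseteq> S'" "w \<in> V - S'"
    and SF: "S = insert w S'" "F = insert b F'"
    by (auto elim: hop_step.cases)
  have "S' \<subseteq> V" "F' \<subseteq> V" using IH by auto
  then have "finite S'" "finite F'" using assms(3) by (auto intro: finite_subset)
  \<comment> \<open>A force adds one new vertex to each component, and the blue set only grows, so
    the neighbours of earlier forcers stay blue.\<close>
  then show ?case using IH st unfolding SF by auto
qed

text \<open>The set of forcers starts empty and gains at most one vertex per step, so no size is
  skipped.\<close>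

lemma hop_reach_intermediate:
  assumes "(hop_step V E)\<^sup>*\<^sup>* (B, {}) (S, F)" "j \<le> card F"
  shows "\<exists>S' F'. (hop_step V E)\<^sup>*\<^sup>* (B, {}) (S', F') \<and> card F' = j"
  using assms
proof (induction "(S, F)" arbitrary: S F rule: rtranclp_induct)
  case base
  have "(hop_step V E)\<^sup>*\<^sup>* (B, {}) (B, {}) \<and> card {} = j" using base by simp
  then show ?case by blast
next
  case (step y)
  obtain S' F' where y: "y = (S', F')" by fastforce
  from step(2)[unfolded y] obtain b where F: "F = insert b F'"
    by (auto elim: hop_step.cases)
  have "card F \<le> Suc (card F')" unfolding F by (rule card_insert_le_m1[of "Suc (card F')", simplified]) auto
  then consider "j \<le> card F'" | "j = card F" using step(4) by linarith
  then show ?case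
  proof cases
    case 1
    then show ?thesis using step(3)[OF y] by blast
  next
    case 2
    then show ?thesis using step(1,2) rtranclp.rtrancl_into_rtrancl by metis
  qed
qed

text \<open>Stop the forcing process after \<open>s\<close> steps: the vertices that have forced have no white
  neighbour, and at least \<open>s\<close> vertices are still white.\<close>

lemma hop_feasible_cut:
  assumes B: "hop_feasible V E B" and V: "finite V" and s: "card B + 2 * s \<le> card V"
  obtains A C where "A \<subseteq> V" "C \<subseteq> V" "A \<inter> C = {}" "card A = s" "card C = s"
    "\<And>a c. a \<in> A \<Longrightarrow> c \<in> C \<Longrightarrow> {a, c} \<notin> E"
proof -
  obtain F where F: "B \<subseteq> V" "(hop_step V E)\<^sup>*\<^sup>* (B, {}) (V, F)"
    using B unfolding hop_feasible_def by blast
  \<comment> \<open>The full process has at least \<open>2 * s\<close> forces. After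
    \<open>s\<close> of them there are \<open>s\<close> forcers, and at least \<open>s\<close>
    vertices are still to be coloured.\<close>
  have "card V = card B + card F" using hop_reach_invariant[OF F(2,1) V] by simp
  then have "s \<le> card F" using s by simp
  then obtain S A where A: "(hop_step V E)\<^sup>*\<^sup>* (B, {}) (S, A)" "card A = s"
    using hop_reach_intermediate[OF F(2)] by blast
  note inv = hop_reach_invariant[OF A(1) F(1) V]
  have "card (V - S) = card V - card S"
    using inv V by (intro card_Diff_subset) (auto intro: finite_subset)
  then have "s \<le> card (V - S)" using inv A(2) s by simp
  then obtain C where C: "C \<subseteq> V - S" "card C = s" by (rule obtain_subset_with_card_n) blast
  show thesis
  proof (rule that[of A C])
    fix a c assume "a \<in> A" "c \<in> C"
    then have "neighbours E a \<subseteq> S" "c \<notin> S" using inv C by auto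
    then show "{a, c} \<notin> E" unfolding neighbours_def by (auto simp: insert_commute)
  qed (use inv C A in auto)
qed

lemma hopping_number_attained:
  assumes "finite V"
  obtains B where "hop_feasible V E B" "card B = hopping_number V E"
proof -
  have "hop_feasible V E V" unfolding hop_feasible_def by auto
  then have "\<exists>k B. hop_feasible V E B \<and> card B = k" by blast
  then have "\<exists>B. hop_feasible V E B \<and> card B = hopping_number V E"
    unfolding hopping_number_def by (rule LeastI_ex)
  then show thesis using that by blast
qed

section \<open>Encoding of regular graphs by words\<close>

fun pairs :: "'a list \<Rightarrow> ('a \<times> 'a) list" where
  "pairs (x # y # zs) = (x, y) # pairs zs"
| "pairs _ = []"

lemma length_pairs [simp]: "length (pairs w) = length w div 2"
  by (induction w rule: pairs.induct) auto

lemma nth_pairs: "i < length w div 2 \<Longrightarrow> pairs w ! i = (w ! (2 * i), w ! (2 * i + 1))"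
proof (induction w arbitrary: i rule: pairs.induct)
  case (1 x y zs)
  then show ?case by (cases i) auto
qed auto

lemma pairs_map: "pairs (map f w) = map (map_prod f f) (pairs w)"
  by (induction w rule: pairs.induct) auto

definition edge_list :: "'a list \<Rightarrow> 'a set list" where
  "edge_list w = map (\<lambda>(a, b). {a, b}) (pairs w)"

lemma edge_list_simps [simp]:
  "edge_list [] = []" "edge_list [x] = []" "edge_list (x # y # zs) = {x, y} # edge_list zs"
  by (auto simp: edge_list_def)

lemma length_edge_list [simp]: "length (edge_list w) = length w div 2"
  by (simp add: edge_list_def)

lemma edge_list_subset: "e \<in> set (edge_list w) \<Longrightarrow> e \<subseteq> set w"
  by (induction w rule: pairs.induct) auto

definition simple_word :: "'a list \<Rightarrow> bool" where
  "simple_word w \<longleftrightarrow> even (length w) \<and> distinct (edge_list w) \<and> (\<forall>e\<in>set (edge_list w). card e = 2)"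

text \<open>The arrangements of this multiset are the configurations of the pairing model, with the
  \<open>d\<close> points of a vertex made indistinguishable.\<close>

definition uniform_mset :: "nat \<Rightarrow> 'a set \<Rightarrow> 'a multiset" where
  "uniform_mset d S = (\<Sum>v\<in>S. replicate_mset d v)"

lemma count_uniform_mset: "finite S \<Longrightarrow> count (uniform_mset d S) v = (if v \<in> S then d else 0)"
  unfolding uniform_mset_def by (simp add: count_sum)

lemma size_uniform_mset [simp]: "size (uniform_mset d S) = d * card S"
  unfolding uniform_mset_def by (simp add: size_multiset_sum)

lemma set_uniform_mset: "finite S \<Longrightarrow> d > 0 \<Longrightarrow> set_mset (uniform_mset d S) = S"
  by (auto simp: count_uniform_mset simp flip: count_greater_zero_iff split: if_splits)

lemma filter_uniform_mset: "finite S \<Longrightarrow> filter_mset P (uniform_mset d S) = uniform_mset d {v\<in>S. P v}"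
  by (intro multiset_eqI) (simp add: count_uniform_mset)

lemma card_words:
  assumes "finite S" "d > 0"
  shows "card (permutations_of_multiset (uniform_mset d S)) * fact d ^ card S = fact (d * card S)"
  using card_permutations_of_multiset_aux[of "uniform_mset d S"] assms
  by (simp add: set_uniform_mset count_uniform_mset)

text \<open>No pair repeats a letter, so every occurrence of \<open>v\<close> lies in a pair of its
  own.\<close>

lemma count_eq_incident:
  assumes "even (length w)" "\<forall>e\<in>set (edge_list w). card e = 2"
  shows "count (mset w) v = length (filter (\<lambda>e. v \<in> e) (edge_list w))"
  using assms by (induction w rule: pairs.induct) (auto simp: card_2_iff doubleton_eq_iff)

lemma card_incident:
  assumes "\<forall>e\<in>E. card e = 2"
  shows "card {e\<in>E. v \<in> e} = card (neighbours E v)"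
proof (rule bij_betw_same_card[symmetric, of "\<lambda>u. {u, v}"])
  show "bij_betw (\<lambda>u. {u, v}) (neighbours E v) {e \<in> E. v \<in> e}"
    unfolding bij_betw_def
  proof
    show "inj_on (\<lambda>u. {u, v}) (neighbours E v)" by (auto simp: inj_on_def doubleton_eq_iff)
    show "(\<lambda>u. {u, v}) ` neighbours E v = {e \<in> E. v \<in> e}"
    proof (intro set_eqI iffI)
      fix e assume e: "e \<in> {e \<in> E. v \<in> e}"
      then have "card e = 2" using assms by auto
      then obtain u where "e = {u, v}" using e by (auto simp: card_2_iff)
      then show "e \<in> (\<lambda>u. {u, v}) ` neighbours E v" using e by (auto simp: neighbours_def)
    qed (auto simp: neighbours_def)
  qed
qed

lemma count_simple_word:
  assumes "simple_word w" shows "count (mset w) v = card (neighbours (set (edge_list w)) v)"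
proof -
  have "count (mset w) v = length (filter (\<lambda>e. v \<in> e) (edge_list w))"
    using assms by (intro count_eq_incident) (auto simp: simple_word_def)
  also have "\<dots> = card {e\<in>set (edge_list w). v \<in> e}"
    using assms by (simp add: simple_word_def distinct_card[symmetric])
  also have "\<dots> = card (neighbours (set (edge_list w)) v)"
    using assms by (intro card_incident) (auto simp: simple_word_def)
  finally show ?thesis .
qed

lemma simple_word_regular:
  assumes "simple_word w" "mset w = uniform_mset d {..<n}"
  shows "set (edge_list w) \<in> regular_graphs n d"
proof -
  have "set w \<subseteq> {..<n}"
  proof
    fix v assume "v \<in> set w"
    then have "count (uniform_mset d {..<n}) v > 0" using assms(2) by (metis count_greater_zero_iff set_mset_mset)
    then show "v \<in> {..<n}" by (auto simp: count_uniform_mset split: if_splits)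
  qed
  then have "\<forall>e\<in>set (edge_list w). e \<subseteq> {..<n} \<and> card e = 2"
    using edge_list_subset[of _ w] assms(1) unfolding simple_word_def by blast
  moreover have "card (neighbours (set (edge_list w)) v) = d" if "v < n" for v
    using count_simple_word[OF assms(1), of v] assms(2) that by (simp add: count_uniform_mset)
  ultimately show ?thesis by (simp add: regular_graphs_def simple_graph_def)
qed

text \<open>Converse of \<open>simple_word_regular\<close>: in a simple word, letter multiplicities
  are degrees, and vertices outside the range have no neighbours.\<close>

lemma regular_simple_word:
  assumes "simple_word w" "set (edge_list w) \<in> regular_graphs n d"
  shows "mset w = uniform_mset d {..<n}"
proof (rule multiset_eqI)
  fix v
  have "neighbours (set (edge_list w)) v = {}" if "\<not> v < n"
    using assms(2) that by (force simp: regular_graphs_def simple_graph_def neighbours_def)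
  then show "count (mset w) v = count (uniform_mset d {..<n}) v"
    using assms by (auto simp: count_uniform_mset count_simple_word[OF assms(1)] regular_graphs_def)
qed

text \<open>Every two-element set can be written in two orders. Evenness excludes a trailing letter,
  which \<open>edge_list\<close> would ignore.\<close>

lemma edge_list_fibre:
  assumes "\<forall>e\<in>set es. card e = 2"
  shows "finite {w. even (length w) \<and> edge_list w = es} \<and> card {w. even (length w) \<and> edge_list w = es} = 2 ^ length es"
  using assms
proof (induction es)
  case Nil
  have "{w. even (length w) \<and> edge_list w = []} = {[] :: 'a list}"
    by (auto elim: pairs.cases)  (metis edge_list_simps(3) list.distinct(1) even_Suc length_Cons list.size(3) pairs.cases even_zero)
  then show ?case by simp
next
  case (Cons e es)
  let ?S = "{w. even (length w) \<and> edge_list w = es}"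
  from Cons.prems obtain a b where e: "e = {a, b}" "a \<noteq> b" by (auto simp: card_2_iff)
  have split: "{w. even (length w) \<and> edge_list w = e # es} = (\<lambda>w. a # b # w) ` ?S \<union> (\<lambda>w. b # a # w) ` ?S"
  proof (intro set_eqI iffI)
    fix w assume w: "w \<in> {w. even (length w) \<and> edge_list w = e # es}"
    then show "w \<in> (\<lambda>w. a # b # w) ` ?S \<union> (\<lambda>w. b # a # w) ` ?S"
      by (cases w rule: pairs.cases) (auto simp: e doubleton_eq_iff)
  qed (auto simp: e)
  have "card ((\<lambda>w. a # b # w) ` ?S) = card ?S" "card ((\<lambda>w. b # a # w) ` ?S) = card ?S"
    by (auto intro!: card_image simp: inj_on_def)
  moreover have "finite ?S" "card ?S = 2 ^ length es" using Cons by auto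
  ultimately show ?case unfolding split using e(2) by (subst card_Un_disjoint) auto
qed

text \<open>The two factors count the orders of the edges and the orders of the ends within each
  edge.\<close>

lemma simple_word_fibre:
  assumes "finite E" "\<forall>e\<in>E. card e = 2"
  shows "finite {w. simple_word w \<and> set (edge_list w) = E}"
    "card {w. simple_word w \<and> set (edge_list w) = E} = fact (card E) * 2 ^ card E"
proof -
  let ?F = "\<lambda>es. {w. even (length w) \<and> edge_list w = es}"
  have eq: "{w. simple_word w \<and> set (edge_list w) = E} = (\<Union>es\<in>permutations_of_set E. ?F es)"
    using assms by (auto simp: simple_word_def permutations_of_set_def)
  have es: "finite (?F es)" "card (?F es) = 2 ^ card E" if "es \<in> permutations_of_set E" for es
    using edge_list_fibre[of es] that assms length_finite_permutations_of_set[OF that]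
      permutations_of_setD[OF that] by auto
  show "finite {w. simple_word w \<and> set (edge_list w) = E}"
    unfolding eq using es assms(1) by auto
  show "card {w. simple_word w \<and> set (edge_list w) = E} = fact (card E) * 2 ^ card E"
    unfolding eq using es assms(1) by (subst card_UN_disjoint) auto
qed

lemma finite_regular_graphs: "finite (regular_graphs n d)"
  by (rule finite_subset[of _ "Pow (Pow {..<n})"]) (auto simp: regular_graphs_def simple_graph_def)

lemma card_regular_edges:
  assumes "E \<in> regular_graphs n d"
  shows "finite E" "\<forall>e\<in>E. card e = 2" "2 * card E = d * n"
proof -
  show fin: "finite E"
    using assms by (intro finite_subset[of E "Pow {..<n}"]) (auto simp: regular_graphs_def simple_graph_def)
  show two: "\<forall>e\<in>E. card e = 2" using assms by (auto simp: regular_graphs_def simple_graph_def)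
  \<comment> \<open>The fibre is nonempty, and the handshake identity is read off from the length of
    any word in it.\<close>
  have "card {w. simple_word w \<and> set (edge_list w) = E} \<noteq> 0" using simple_word_fibre[OF fin two] by simp
  then obtain w where w: "simple_word w" "set (edge_list w) = E"
    by (metis (mono_tags, lifting) card.empty empty_Collect_eq)
  then have "length w = d * n" using regular_simple_word[of w n d] assms
    by (metis card_lessThan size_mset size_uniform_mset)
  moreover have "card E = length w div 2" using w distinct_card[of "edge_list w"]
    by (simp add: simple_word_def)
  ultimately show "2 * card E = d * n" using w(1) by (simp add: simple_word_def)
qed

text \<open>All fibres have equal size, so proportions of regular graphs equal proportions of simple
  words.\<close>

lemma card_simple_words:
  assumes "\<E> \<subseteq> regular_graphs n d"
  shows "card {w \<in> permutations_of_multiset (uniform_mset d {..<n}). simple_word w \<and> set (edge_list w) \<in> \<E>}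
    = card \<E> * (fact (d * n div 2) * 2 ^ (d * n div 2))"
proof -
  let ?F = "\<lambda>E. {w. simple_word w \<and> set (edge_list w) = E}"
  have "{w \<in> permutations_of_multiset (uniform_mset d {..<n}). simple_word w \<and> set (edge_list w) \<in> \<E>} = (\<Union>E\<in>\<E>. ?F E)"
    using regular_simple_word assms by (auto simp: permutations_of_multiset_def)
  moreover have "finite (?F E) \<and> card (?F E) = fact (d * n div 2) * 2 ^ (d * n div 2)" if "E \<in> \<E>" for E
  proof -
    have E: "E \<in> regular_graphs n d" using that assms by blast
    have "card E = d * n div 2" using card_regular_edges(3)[OF E] by linarith
    then show ?thesis using simple_word_fibre[OF card_regular_edges(1,2)[OF E]] by simp
  qed
  moreover have "finite \<E>" using assms finite_regular_graphs finite_subset by blast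
  ultimately show ?thesis by (subst \<open>_ = (\<Union>E\<in>\<E>. ?F E)\<close>, subst card_UN_disjoint) auto
qed

section \<open>Counting words without edges across a cut\<close>

lemma sum_weight_pair_words:
  fixes \<omega> :: "'a \<Rightarrow> real"
  assumes "finite P"
  shows "finite {ts. length ts = 2 * M \<and> set (pairs ts) \<subseteq> P} \<and>
    (\<Sum>ts\<in>{ts. length ts = 2 * M \<and> set (pairs ts) \<subseteq> P}. prod_list (map \<omega> ts)) = (\<Sum>(a, b)\<in>P. \<omega> a * \<omega> b) ^ M"
proof (induction M)
  case 0
  have "{ts. length ts = 2 * 0 \<and> set (pairs ts) \<subseteq> P} = {[]}" by auto
  then show ?case by simp
next
  case (Suc M)
  let ?S = "\<lambda>M. {ts. length ts = 2 * M \<and> set (pairs ts) \<subseteq> P}"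
  let ?f = "\<lambda>((a, b), ts). a # b # ts"
  have S: "?S (Suc M) = ?f ` (P \<times> ?S M)"
  proof (intro set_eqI iffI)
    fix ts assume ts: "ts \<in> ?S (Suc M)"
    then show "ts \<in> ?f ` (P \<times> ?S M)"
      by (cases ts rule: pairs.cases) (auto intro!: image_eqI[of _ _ "((_, _), _)"])
  qed auto
  have inj: "inj_on ?f (P \<times> ?S M)" by (auto simp: inj_on_def)
  have "(\<Sum>ts\<in>?S (Suc M). prod_list (map \<omega> ts)) = (\<Sum>(p, ts)\<in>P \<times> ?S M. \<omega> (fst p) * \<omega> (snd p) * prod_list (map \<omega> ts))"
    unfolding S by (subst sum.reindex[OF inj]) (auto intro!: sum.cong simp: algebra_simps)
  also have "\<dots> = (\<Sum>p\<in>P. \<omega> (fst p) * \<omega> (snd p)) * (\<Sum>ts\<in>?S M. prod_list (map \<omega> ts))"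
    by (simp add: sum_product sum.cartesian_product)
  finally show ?case using Suc assms unfolding S by (auto simp: case_prod_beta)
qed

text \<open>The types tell from which of the one-type subwords each successive letter is
  taken.\<close>

lemma list_eq_if_map_filter_eq:
  assumes "map f w = map f w'" "\<And>k. filter (\<lambda>x. f x = k) w = filter (\<lambda>x. f x = k) w'"
  shows "w = w'"
  using assms
proof (induction w arbitrary: w')
  case (Cons x w)
  then obtain y v where w': "w' = y # v" "f x = f y" "map f w = map f v" by (cases w') auto
  have x: "x = y" using Cons.prems(2)[of "f x"] w' by simp
  moreover have "w = v"
  proof (rule Cons.IH[OF w'(3)])
    show "filter (\<lambda>x. f x = k) w = filter (\<lambda>x. f x = k) v" for k
      using Cons.prems(2)[of k] w'(1) x by (auto split: if_splits)
  qed
  ultimately show ?case using w' by simp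
qed simp

lemma prod_lessThan_3: "(\<Prod>k<3. f k) = f 0 * f 1 * f (2 :: nat)"
  by (simp add: eval_nat_numeral lessThan_Suc algebra_simps)

text \<open>By \<open>list_eq_if_map_filter_eq\<close> a word is determined by its type word and
  three subwords. Each subword arranges a uniform multiset, and the factors \<open>fact d\<close>
  are shared out among the classes.\<close>

lemma card_words_by_type:
  fixes ty :: "'a \<Rightarrow> nat"
  assumes fin: "finite V" and d: "d > 0" and ty: "\<And>v. ty v < 3" and TT: "finite TT"
    and W: "\<W> \<subseteq> permutations_of_multiset (uniform_mset d V)" and map: "\<And>w. w \<in> \<W> \<Longrightarrow> map ty w \<in> TT"
  shows "card \<W> * fact d ^ card V \<le> card TT * (\<Prod>k<3. fact (d * card {v\<in>V. ty v = k}))"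
proof -
  let ?p = "\<lambda>k. permutations_of_multiset (uniform_mset d {v\<in>V. ty v = k})"
  let ?f = "\<lambda>w. (map ty w, filter (\<lambda>x. ty x = 0) w, filter (\<lambda>x. ty x = 1) w, filter (\<lambda>x. ty x = 2) w)"
  have "filter (\<lambda>x. ty x = k) w \<in> ?p k" if "w \<in> \<W>" for w k
    using that W fin by (auto simp: permutations_of_multiset_def filter_uniform_mset)
  then have sub: "?f ` \<W> \<subseteq> TT \<times> ?p 0 \<times> ?p 1 \<times> ?p 2" using map by auto
  have inj: "inj_on ?f \<W>"
  proof (rule inj_onI)
    fix w w' :: "'a list" assume w: "?f w = ?f w'"
    show "w = w'"
    proof (rule list_eq_if_map_filter_eq[of ty])
      show "map ty w = map ty w'" using w by simp
      fix k :: nat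
      consider "k = 0" | "k = 1" | "k = 2" | "k \<ge> 3" by linarith
      then show "filter (\<lambda>x. ty x = k) w = filter (\<lambda>x. ty x = k) w'"
      proof cases
        case 4
        then have "ty x \<noteq> k" for x using ty[of x] by linarith
        then show ?thesis by simp
      qed (use w in auto)
    qed
  qed
  have "card \<W> \<le> card (TT \<times> ?p 0 \<times> ?p 1 \<times> ?p 2)"
    using card_inj_on_le[OF inj sub] TT by simp
  then have le: "card \<W> \<le> card TT * (\<Prod>k<3. card (?p k))"
    by (simp add: card_cartesian_product eval_nat_numeral lessThan_Suc algebra_simps)
  have "card V = (\<Sum>k<3. card {v\<in>V. ty v = k})"
  proof -
    have "V = (\<Union>k<3. {v\<in>V. ty v = k})" using ty by auto
    then have "card V = card (\<Union>k<3. {v\<in>V. ty v = k})" by simp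
    also have "\<dots> = (\<Sum>k<3. card {v\<in>V. ty v = k})" using fin by (intro card_UN_disjoint) auto
    finally show ?thesis .
  qed
  then have "card \<W> * fact d ^ card V \<le> card TT * (\<Prod>k<3. card (?p k)) * (\<Prod>k<3. fact d ^ card {v\<in>V. ty v = k})"
    using le by (simp add: power_sum)
  also have "\<dots> = card TT * (\<Prod>k<3. card (?p k) * fact d ^ card {v\<in>V. ty v = k})"
    by (simp add: prod.distrib)
  also have "\<dots> = card TT * (\<Prod>k<3. fact (d * card {v\<in>V. ty v = k}))"
    using fin d by (intro arg_cong2[of _ _ _ _ "(*)"] prod.cong refl card_words) simp_all
  finally show ?thesis .
qed

lemma prod_list_by_count:
  fixes \<omega> :: "nat \<Rightarrow> real"
  assumes "\<forall>t\<in>set ts. t < 3"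
  shows "prod_list (map \<omega> ts) = (\<Prod>k<3. \<omega> k ^ count (mset ts) k)"
  using assms
proof (induction ts)
  case (Cons t ts)
  then have "t = 0 \<or> t = 1 \<or> t = 2" by auto
  then show ?case using Cons by (auto simp: eval_nat_numeral lessThan_Suc)
qed simp

definition avoiding_words :: "nat \<Rightarrow> 'a set \<Rightarrow> 'a set \<Rightarrow> 'a set \<Rightarrow> 'a list set" where
  "avoiding_words d V A C = {w \<in> permutations_of_multiset (uniform_mset d V).
     \<forall>(a, b)\<in>set (pairs w). \<not> (a \<in> A \<and> b \<in> C) \<and> \<not> (a \<in> C \<and> b \<in> A)}"

text \<open>Exponential weighting of type words: the admissible ones have total weight 1, and those
  with the right letter counts all have the same weight, so their number is at most its
  reciprocal.\<close>

lemma card_avoiding_words: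
  fixes u w :: real
  assumes V: "finite V" and d: "d > 0" "even (d * card V)"
    and AC: "A \<subseteq> V" "C \<subseteq> V" "A \<inter> C = {}" "card A = s" "card C = s"
    and uw: "u > 0" "w > 0" "2 * u\<^sup>2 + 4 * (u * w) + w\<^sup>2 = 1"
  shows "real (card (avoiding_words d V A C)) * fact d ^ card V * (u ^ (2 * d * s) * w ^ (d * (card V - 2 * s)))
    \<le> fact (d * s) ^ 2 * fact (d * (card V - 2 * s))"
proof -
  define ty :: "'a \<Rightarrow> nat" where "ty v = (if v \<in> A then 0 else if v \<in> C then 1 else 2)" for v
  \<comment> \<open>All ordered pairs of types except \<open>(0,1)\<close> and \<open>(1,0)\<close>;
    their total weight is \<open>2 * u\<^sup>2 + 4 * (u * w) + w\<^sup>2\<close>.\<close>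
  define P :: "(nat \<times> nat) set" where "P = {(0,0), (0,2), (2,0), (1,1), (1,2), (2,1), (2,2)}"
  define \<omega> :: "nat \<Rightarrow> real" where "\<omega> k = (if k = 2 then w else u)" for k
  obtain M where M: "d * card V = 2 * M" using d(2) by blast
  define T0 where "T0 = {ts. length ts = 2 * M \<and> set (pairs ts) \<subseteq> P}"
  define N where "N k = card {v\<in>V. ty v = k}" for k
  define TT where "TT = {ts \<in> T0. (\<forall>t\<in>set ts. t < 3) \<and> (\<forall>k<3. count (mset ts) k = d * N k)}"
  have cls: "{v\<in>V. ty v = 0} = A" "{v\<in>V. ty v = 1} = C" "{v\<in>V. ty v = 2} = V - A - C"
    using AC by (auto simp: ty_def)
  have fin: "finite A" "finite C" using AC V finite_subset by auto
  have "card (V - A - C) = card V - card A - card C"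
    using AC fin by (subst card_Diff_subset, simp, blast, subst card_Diff_subset) auto
  then have N: "N 0 = s" "N 1 = s" "N 2 = card V - 2 * s" unfolding N_def cls using AC by auto
  have T0: "finite T0" "(\<Sum>ts\<in>T0. prod_list (map \<omega> ts)) = 1"
  proof -
    have "(\<Sum>(a, b)\<in>P. \<omega> a * \<omega> b) = 1"
      using uw(3) unfolding P_def \<omega>_def by (simp add: power2_eq_square algebra_simps)
    then show "finite T0" "(\<Sum>ts\<in>T0. prod_list (map \<omega> ts)) = 1"
      using sum_weight_pair_words[of P M \<omega>] unfolding T0_def by (auto simp: P_def)
  qed
  have TT: "finite TT" using T0(1) by (simp add: TT_def)
  define X where "X = u ^ (2 * d * s) * w ^ (d * (card V - 2 * s))"
  have X: "prod_list (map \<omega> ts) = X" if "ts \<in> TT" for ts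
  proof -
    have "prod_list (map \<omega> ts) = (\<Prod>k<3. \<omega> k ^ count (mset ts) k)"
      using that by (intro prod_list_by_count) (auto simp: TT_def)
    also have "\<dots> = (\<Prod>k<3. \<omega> k ^ (d * N k))" using that by (intro prod.cong) (auto simp: TT_def)
    also have "\<dots> = \<omega> 0 ^ (d * N 0) * \<omega> 1 ^ (d * N 1) * \<omega> 2 ^ (d * N 2)"
      by (rule prod_lessThan_3)
    also have "\<dots> = X" unfolding N X_def \<omega>_def
      by (simp add: power_add[symmetric] mult_2 mult_2_right algebra_simps)
    finally show ?thesis .
  qed
  have "real (card TT) * X = (\<Sum>ts\<in>TT. prod_list (map \<omega> ts))" using X by simp
  also have "\<dots> \<le> (\<Sum>ts\<in>T0. prod_list (map \<omega> ts))"
    using T0(1) uw by (intro sum_mono2) (auto simp: TT_def \<omega>_def intro!: prod_list_nonneg)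
  finally have TTX: "real (card TT) * X \<le> 1" using T0(2) by simp
  have "card (avoiding_words d V A C) * fact d ^ card V \<le> card TT * (\<Prod>k<3. fact (d * card {v\<in>V. ty v = k}))"
  proof (rule card_words_by_type[OF V d(1) _ TT])
    show "ty v < 3" for v by (simp add: ty_def)
    show "avoiding_words d V A C \<subseteq> permutations_of_multiset (uniform_mset d V)"
      by (auto simp: avoiding_words_def)
    fix ws assume ws: "ws \<in> avoiding_words d V A C"
    then have m: "mset ws = uniform_mset d V" by (auto simp: avoiding_words_def permutations_of_multiset_def)
    have "length (map ty ws) = 2 * M" using M arg_cong[OF m, of size] by simp
    moreover have "set (pairs (map ty ws)) \<subseteq> P"
    proof
      fix p assume "p \<in> set (pairs (map ty ws))"
      then obtain a b where ab: "(a, b) \<in> set (pairs ws)" "p = (ty a, ty b)" by (auto simp: pairs_map)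
      then have "\<not> (a \<in> A \<and> b \<in> C)" "\<not> (a \<in> C \<and> b \<in> A)"
        using ws unfolding avoiding_words_def by auto
      then show "p \<in> P" unfolding ab(2) ty_def P_def by (cases "a \<in> A"; cases "b \<in> A") auto
    qed
    moreover have "count (mset (map ty ws)) k = d * N k" for k
    proof -
      have "count (mset (map ty ws)) k = size (filter_mset (\<lambda>v. ty v = k) (mset ws))"
        by (induction ws) auto
      also have "\<dots> = d * N k" unfolding m N_def using V by (simp add: filter_uniform_mset)
      finally show ?thesis .
    qed
    ultimately show "map ty ws \<in> TT" by (auto simp: TT_def T0_def ty_def)
  qed
  also have "(\<Prod>k<3. fact (d * card {v\<in>V. ty v = k})) = (fact (d * s) ^ 2 * fact (d * (card V - 2 * s)) :: nat)"
    unfolding prod_lessThan_3 N[unfolded N_def] power2_eq_square ..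
  finally have "real (card (avoiding_words d V A C) * fact d ^ card V)
      \<le> real (card TT * (fact (d * s) ^ 2 * fact (d * (card V - 2 * s))))"
    by (simp only: of_nat_le_iff)
  then have "real (card (avoiding_words d V A C)) * fact d ^ card V * X
      \<le> real (card TT) * (fact (d * s) ^ 2 * fact (d * (card V - 2 * s))) * X"
    using uw unfolding X_def by (intro mult_right_mono) auto
  also have "\<dots> = (real (card TT) * X) * (fact (d * s) ^ 2 * fact (d * (card V - 2 * s)))" by simp
  also have "\<dots> \<le> 1 * (fact (d * s) ^ 2 * fact (d * (card V - 2 * s)))"
    using TTX by (intro mult_right_mono) auto
  finally show ?thesis unfolding X_def by simp
qed

section \<open>Random switchings\<close>

definition mate :: "nat \<Rightarrow> nat" where
  "mate p = (if even p then p + 1 else p - 1)"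

lemma mate_mate [simp]: "mate (mate p) = p"
  by (auto simp: mate_def)

lemma mate_neq [simp]: "mate p \<noteq> p" "p \<noteq> mate p"
  by (auto simp: mate_def elim: oddE)

lemma mate_eq_iff [simp]: "mate p = mate q \<longleftrightarrow> p = q"
  by (metis mate_mate)

lemma mate_less: "even L \<Longrightarrow> p < L \<Longrightarrow> mate p < L"
  by (auto simp: mate_def elim!: evenE)

definition loops :: "nat \<Rightarrow> (nat \<Rightarrow> 'a) \<Rightarrow> nat set" where
  "loops L f = {p. p < L \<and> f p = f (mate p)}"

text \<open>Defects are recorded as positions, so a bad pair contributes both of its positions.
  Words are read as functions of the position, which makes a swap a composition with a
  transposition.\<close>

definition defects :: "nat \<Rightarrow> (nat \<Rightarrow> 'a) \<Rightarrow> nat set" where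
  "defects L f = {p. p < L \<and> (f p = f (mate p) \<or>
     (\<exists>j<L. j \<noteq> p \<and> j \<noteq> mate p \<and> {f j, f (mate j)} = {f p, f (mate p)}))}"

lemma loops_subset_defects: "loops L f \<subseteq> defects L f"
  by (auto simp: loops_def defects_def)

lemma finite_loops [simp]: "finite (loops L f)"
  by (rule finite_subset[of _ "{..<L}"]) (auto simp: loops_def)

lemma finite_defects [simp]: "finite (defects L f)"
  by (rule finite_subset[of _ "{..<L}"]) (auto simp: defects_def)

lemma mate_defects: "even L \<Longrightarrow> p \<in> defects L f \<Longrightarrow> mate p \<in> defects L f"
  by (auto simp: defects_def mate_less insert_commute)

text \<open>The last alternative, in which the swap merges two loops into a double edge, is the only one
  that can hold for more than a bounded number of \<open>q\<close>.\<close>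

lemma defect_after_swap:
  assumes L: "even L" "q < L" and q: "q \<noteq> p" "q \<noteq> mate p"
    and def: "p \<in> defects L (f \<circ> Transposition.transpose p q)"
  shows "f q = f (mate p) \<or> (\<exists>j<L. f j = f (mate p) \<and> f q = f (mate j)) \<or> f q = f p
    \<or> (f q = f (mate q) \<and> f p = f (mate p))"
proof -
  have q': "mate q \<noteq> p" "mate q \<noteq> mate p" using q by auto
  define f2 where "f2 = f \<circ> Transposition.transpose p q"
  have f2: "f2 p = f q" "f2 (mate p) = f (mate p)" "f2 q = f p" "f2 (mate q) = f (mate q)"
    using q q' by (auto simp: f2_def Transposition.transpose_def)
  have other: "f2 j = f j" if "j \<noteq> p" "j \<noteq> q" for j using that by (simp add: f2_def Transposition.transpose_def)
  from def consider "f2 p = f2 (mate p)"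
    | j where "j < L" "j \<noteq> p" "j \<noteq> mate p" "{f2 j, f2 (mate j)} = {f2 p, f2 (mate p)}"
    unfolding f2_def[symmetric] defects_def by blast
  then show ?thesis
  proof cases
    case 1
    then show ?thesis using f2 by simp
  next
    case (2 j)
    show ?thesis
    proof (cases "j = q \<or> j = mate q")
      case True
      then have "{f2 j, f2 (mate j)} = {f p, f (mate q)}"
        by (elim disjE) (simp_all only: f2 mate_mate insert_commute)
      then have "{f p, f (mate q)} = {f q, f (mate p)}" using 2(4) by (simp only: f2)
      \<comment> \<open>Matching the two doubletons gives either \<open>f p = f q\<close> or the two
        loops \<open>f p = f (mate p)\<close> and \<open>f q = f (mate q)\<close>.\<close>
      then show ?thesis by (auto simp: doubleton_eq_iff)
    next
      case False
      then have "mate j \<noteq> p" "mate j \<noteq> q" using 2 by auto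
      then have "{f j, f (mate j)} = {f q, f (mate p)}" using 2(2-4) False by (simp only: f2 other simp_thms de_Morgan_disj)
      moreover have "mate j < L" using 2(1) L by (simp add: mate_less)
      ultimately show ?thesis using 2(1) by (metis doubleton_eq_iff mate_mate)
    qed
  qed
qed

text \<open>If \<open>p\<close> and \<open>q\<close> are sound after the swap, so are their mates,
  and every remaining defect lies in untouched pairs, where it existed before.\<close>

lemma defects_swap_subset:
  assumes L: "even L" "p < L" "q < L"
    and p: "p \<notin> defects L (f \<circ> Transposition.transpose p q)" and q: "q \<notin> defects L (f \<circ> Transposition.transpose p q)"
  shows "defects L (f \<circ> Transposition.transpose p q) \<subseteq> defects L f - {p}"
proof
  define f2 where "f2 = f \<circ> Transposition.transpose p q"
  have mp: "mate p \<notin> defects L f2" "mate q \<notin> defects L f2"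
    using mate_defects[OF L(1)] p q mate_mate unfolding f2_def by metis+
  have other: "f2 j = f j" if "j \<noteq> p" "j \<noteq> q" for j using that by (simp add: f2_def Transposition.transpose_def)
  have away: "j \<noteq> p \<and> j \<noteq> q \<and> mate j \<noteq> p \<and> mate j \<noteq> q" if "j \<in> defects L f2" for j
    using that mp p q unfolding f2_def[symmetric] by (metis mate_mate)
  fix i assume "i \<in> defects L (f \<circ> Transposition.transpose p q)"
  then have i: "i \<in> defects L f2" by (simp add: f2_def)
  then have fi: "f2 i = f i" "f2 (mate i) = f (mate i)" using away[OF i] other by auto
  have "i \<in> defects L f"
  proof (cases "f2 i = f2 (mate i)")
    case True
    then show ?thesis using fi i by (auto simp: defects_def)
  next
    case False
    then obtain j where j: "j < L" "j \<noteq> i" "j \<noteq> mate i" "{f2 j, f2 (mate j)} = {f2 i, f2 (mate i)}"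
      using i by (auto simp: defects_def)
    have "i < L" using i by (simp add: defects_def)
    moreover have "i \<noteq> mate j" using j(3) by auto
    \<comment> \<open>Being parallel is symmetric: the pair that witnesses a defect is itself
      defective and hence also untouched.\<close>
    ultimately have "j \<in> defects L f2" unfolding defects_def using j by auto
    then have "f2 j = f j" "f2 (mate j) = f (mate j)" using away other by auto
    then show ?thesis unfolding defects_def using j fi \<open>i < L\<close> by auto
  qed
  then show "i \<in> defects L f - {p}" using away[OF i] by simp
qed

context
  fixes L d :: nat and f :: "nat \<Rightarrow> 'a"
  assumes L: "even L" and occ: "\<And>v. card {q. q < L \<and> f q = v} \<le> d"
begin

lemma card_mate_occ: "card {q. q < L \<and> f (mate q) = v} \<le> d"
proof -
  have "card {q. q < L \<and> f (mate q) = v} = card (mate ` {q. q < L \<and> f (mate q) = v})"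
    by (rule card_image[symmetric]) (auto simp: inj_on_def)
  also have "\<dots> \<le> card {q. q < L \<and> f q = v}"
    using L by (intro card_mono) (auto simp: mate_less)
  also have "\<dots> \<le> d" by (rule occ)
  finally show ?thesis .
qed

text \<open>There are at most \<open>d\<close> choices of \<open>j\<close>, and for each at most
  \<open>d\<close> positions \<open>q\<close>. The second function allows both \<open>f\<close> and
  \<open>f \<circ> mate\<close> below.\<close>

lemma card_second_occ:
  assumes f': "\<And>v. card {q. q < L \<and> f' q = v} \<le> d"
  shows "card {q. q < L \<and> (\<exists>j<L. f j = v \<and> f' q = f (mate j))} \<le> d * d"
proof -
  have "{q. q < L \<and> (\<exists>j<L. f j = v \<and> f' q = f (mate j))}
      = (\<Union>j\<in>{j. j < L \<and> f j = v}. {q. q < L \<and> f' q = f (mate j)})" by auto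
  then have "card {q. q < L \<and> (\<exists>j<L. f j = v \<and> f' q = f (mate j))}
      \<le> (\<Sum>j\<in>{j. j < L \<and> f j = v}. card {q. q < L \<and> f' q = f (mate j)})"
    by (simp add: card_UN_le)
  also have "\<dots> \<le> card {j. j < L \<and> f j = v} * d"
    using sum_bounded_above[of "{j. j < L \<and> f j = v}" "\<lambda>j. card {q. q < L \<and> f' q = f (mate j)}" d] f' by simp
  also have "\<dots> \<le> d * d" by (intro mult_right_mono occ) simp
  finally show ?thesis .
qed

lemma card_loop_creating: "card {q. q < L \<and> p \<in> loops L (f \<circ> Transposition.transpose p q)} \<le> d + 2"
proof -
  have "{q. q < L \<and> p \<in> loops L (f \<circ> Transposition.transpose p q)} \<subseteq> {q. q < L \<and> f q = f (mate p)} \<union> {p, mate p}"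
    by (auto simp: loops_def Transposition.transpose_def split: if_splits)
  then have "card {q. q < L \<and> p \<in> loops L (f \<circ> Transposition.transpose p q)} \<le> card ({q. q < L \<and> f q = f (mate p)} \<union> {p, mate p})"
    by (intro card_mono) auto
  also have "\<dots> \<le> card {q. q < L \<and> f q = f (mate p)} + card {p, mate p}" by (rule card_Un_le)
  also have "\<dots> \<le> d + 2" using occ[of "f (mate p)"] by simp
  finally show ?thesis .
qed

text \<open>A union bound over the alternatives of \<open>defect_after_swap\<close>; the last one
  requires both \<open>p\<close> and \<open>q\<close> to be loops, which gives the conditional
  term.\<close>

lemma card_defect_creating:
  assumes p: "p < L"
  shows "card {q. q < L \<and> p \<in> defects L (f \<circ> Transposition.transpose p q)}
    \<le> d * d + 2 * d + 2 + (if p \<in> loops L f then card (loops L f) else 0)"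
proof -
  let ?N = "\<lambda>v. {q. q < L \<and> f q = v}"
  let ?N2 = "{q. q < L \<and> (\<exists>j<L. f j = f (mate p) \<and> f q = f (mate j))}"
  let ?l = "if p \<in> loops L f then loops L f else {}"
  have "{q. q < L \<and> p \<in> defects L (f \<circ> Transposition.transpose p q)}
      \<subseteq> ?N2 \<union> (?N (f (mate p)) \<union> ?N (f p)) \<union> {p, mate p} \<union> ?l"
  proof
    fix q assume q: "q \<in> {q. q < L \<and> p \<in> defects L (f \<circ> Transposition.transpose p q)}"
    then have qL: "q < L" "p \<in> defects L (f \<circ> Transposition.transpose p q)" by auto
    show "q \<in> ?N2 \<union> (?N (f (mate p)) \<union> ?N (f p)) \<union> {p, mate p} \<union> ?l"
    proof (cases "q = p \<or> q = mate p")
      case False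
      then show ?thesis using defect_after_swap[OF L qL(1) _ _ qL(2)] qL(1) p unfolding loops_def by auto
    qed auto
  qed
  then have "card {q. q < L \<and> p \<in> defects L (f \<circ> Transposition.transpose p q)}
      \<le> card (?N2 \<union> (?N (f (mate p)) \<union> ?N (f p)) \<union> {p, mate p} \<union> ?l)"
    by (intro card_mono) auto
  also have "\<dots> \<le> card ?N2 + (card (?N (f (mate p))) + card (?N (f p))) + card {p, mate p} + card ?l"
    by (meson card_Un_le order_trans add_mono order_refl)
  also have "\<dots> \<le> d * d + (d + d) + 2 + (if p \<in> loops L f then card (loops L f) else 0)"
    using occ by (intro add_mono card_second_occ) auto
  finally show ?thesis by simp
qed

text \<open>All but boundedly many \<open>q\<close>, apart from loops, make both \<open>p\<close>
  and \<open>q\<close> sound after the swap, and then \<open>defects_swap_subset\<close>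
  applies.\<close>

lemma defect_reducing_swap:
  assumes p: "p \<in> defects L f" and big: "L > 2 * (d * d) + 3 * d + 2 + card (defects L f)"
  obtains q where "q < L" "card (defects L (f \<circ> Transposition.transpose p q)) < card (defects L f)"
proof -
  let ?N = "\<lambda>v. {q. q < L \<and> f q = v}"
  \<comment> \<open>The primed sets are the obstructions for \<open>q\<close> instead of
    \<open>p\<close>, from \<open>defect_after_swap\<close> with the two positions
    exchanged.\<close>
  let ?N' = "{q. q < L \<and> f (mate q) = f p}"
  let ?N2 = "{q. q < L \<and> (\<exists>j<L. f j = f (mate p) \<and> f q = f (mate j))}"
  let ?N2' = "{q. q < L \<and> (\<exists>j<L. f j = f p \<and> f (mate q) = f (mate j))}"
  let ?bad = "?N2 \<union> ?N2' \<union> (?N (f (mate p)) \<union> ?N (f p) \<union> ?N') \<union> {p, mate p} \<union> loops L f"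
  have pL: "p < L" using p by (simp add: defects_def)
  have "card ?bad \<le> card ?N2 + card ?N2' + (card (?N (f (mate p))) + card (?N (f p)) + card ?N')
      + card {p, mate p} + card (loops L f)"
    by (meson card_Un_le order_trans add_mono order_refl)
  also have "\<dots> \<le> d * d + d * d + (d + d + d) + 2 + card (defects L f)"
    using occ card_mate_occ by (intro add_mono card_second_occ card_mono loops_subset_defects) auto
  also have "\<dots> < L" using big by simp
  finally have "card ?bad < card {..<L}" by simp
  moreover have "finite ?bad" by auto
  ultimately have "\<not> {..<L} \<subseteq> ?bad" using card_mono[of ?bad "{..<L}"] by linarith
  then obtain q where q: "q < L" "q \<notin> ?bad" by blast
  have qp: "q \<noteq> p" "q \<noteq> mate p" using q by auto
  have 1: "p \<notin> defects L (f \<circ> Transposition.transpose p q)"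
    using defect_after_swap[OF L q(1) qp, of f] q by (auto simp: loops_def)
  have 2: "q \<notin> defects L (f \<circ> Transposition.transpose p q)"
  proof
    assume "q \<in> defects L (f \<circ> Transposition.transpose p q)"
    then have "q \<in> defects L (f \<circ> Transposition.transpose q p)" by (simp add: Transposition.transpose_commute)
    moreover have "p \<noteq> mate q" using qp by auto
    ultimately consider "f p = f (mate q)" | j where "j < L" "f j = f (mate q)" "f p = f (mate j)"
      | "f p = f q" | "f q = f (mate q)"
      using defect_after_swap[OF L pL, of q f] qp by metis
    then show False
    proof cases
      case (2 j)
      \<comment> \<open>The position that shows membership in \<open>?N2'\<close> is
        \<open>mate j\<close>, not \<open>j\<close>.\<close>
      then have "mate j < L" "f (mate j) = f p" "f (mate q) = f (mate (mate j))" using L by (auto simp: mate_less)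
      then have "q \<in> ?N2'" using q(1) by blast
      then show ?thesis using q by blast
    qed (use q in \<open>auto simp: loops_def\<close>)
  qed
  have "defects L (f \<circ> Transposition.transpose p q) \<subset> defects L f"
    using defects_swap_subset[OF L pL q(1) 1 2] p by blast
  then have "card (defects L (f \<circ> Transposition.transpose p q)) < card (defects L f)"
    by (intro psubset_card_mono) auto
  with q(1) show thesis using that by blast
qed

end

section \<open>Average number of defects and the fraction of simple words\<close>

definition swap_word :: "nat \<Rightarrow> nat \<Rightarrow> 'a list \<Rightarrow> 'a list" where
  "swap_word p q w = w[q := w ! p, p := w ! q]"

lemma length_swap_word [simp]: "length (swap_word p q w) = length w"
  by (simp add: swap_word_def)

lemma nth_swap_word:
  "p < length w \<Longrightarrow> q < length w \<Longrightarrow> i < length w \<Longrightarrow> swap_word p q w ! i = (nth w \<circ> Transposition.transpose p q) i"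
  by (auto simp: swap_word_def Transposition.transpose_def nth_list_update)

lemma mset_swap_word: "p < length w \<Longrightarrow> q < length w \<Longrightarrow> mset (swap_word p q w) = mset w"
  unfolding swap_word_def by (rule mset_swap)

lemma swap_word_swap_word: "p < length w \<Longrightarrow> q < length w \<Longrightarrow> swap_word p q (swap_word p q w) = w"
  by (rule nth_equalityI) (auto simp: nth_swap_word Transposition.transpose_def)

lemma swap_word_same [simp]: "swap_word p p w = w"
  by (simp add: swap_word_def)

lemma defects_cong:
  assumes "even L" "\<And>i. i < L \<Longrightarrow> f i = f' i" shows "defects L f = defects L f'"
  unfolding defects_def using assms mate_less[OF assms(1)] by (intro Collect_cong) (metis (no_types, lifting))

lemma loops_cong:
  assumes "even L" "\<And>i. i < L \<Longrightarrow> f i = f' i" shows "loops L f = loops L f'"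
  unfolding loops_def using assms mate_less[OF assms(1)] by auto

lemma simple_word_if_no_defects:
  assumes "even (length w)" "defects (length w) (nth w) = {}"
  shows "simple_word w"
proof -
  let ?L = "length w"
  have e: "edge_list w ! i = {w ! (2 * i), w ! (2 * i + 1)}" if "i < ?L div 2" for i
    using that by (simp add: edge_list_def nth_pairs)
  have no: "w ! (2 * i) \<noteq> w ! (2 * i + 1)" if "i < ?L div 2" for i
  proof -
    have "2 * i \<notin> defects ?L (nth w)" "2 * i < ?L" using assms that by auto
    then show ?thesis by (auto simp: defects_def mate_def)
  qed
  have dist: "edge_list w ! i \<noteq> edge_list w ! j" if "i < ?L div 2" "j < ?L div 2" "i \<noteq> j" for i j
  proof
    assume "edge_list w ! i = edge_list w ! j"
    then have "{w ! (2 * j), w ! mate (2 * j)} = {w ! (2 * i), w ! mate (2 * i)}"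
      using e that by (simp add: mate_def)
    moreover have "2 * i < ?L" "2 * j < ?L" "2 * j \<noteq> 2 * i" "2 * j \<noteq> mate (2 * i)"
      using that by (auto simp: mate_def)
    ultimately have "2 * i \<in> defects ?L (nth w)" unfolding defects_def by blast
    then show False using assms by simp
  qed
  have "distinct (edge_list w)" using dist by (auto simp: distinct_conv_nth)
  moreover have "card x = 2" if x: "x \<in> set (edge_list w)" for x
  proof -
    obtain i where "i < ?L div 2" "x = edge_list w ! i" using x by (auto simp: in_set_conv_nth)
    then show ?thesis using no[of i] e[of i] by simp
  qed
  ultimately show ?thesis using assms by (simp add: simple_word_def)
qed

context
  fixes V :: "'a set" and d L :: nat and \<W> :: "'a list set"
  assumes V: "finite V" and L: "L = d * card V" "even L"
    and \<W>: "\<W> = permutations_of_multiset (uniform_mset d V)"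
begin

lemma words_fin: "finite \<W>" by (simp add: \<W>)

lemma words_length: "w \<in> \<W> \<Longrightarrow> length w = L"
  using size_mset[of w] by (auto simp: \<W> L(1) permutations_of_multiset_def)

lemma words_occ:
  assumes "w \<in> \<W>" shows "card {q. q < L \<and> w ! q = v} \<le> d"
proof -
  have "card {q. q < L \<and> w ! q = v} = count (mset w) v"
    using words_length[OF assms] by (simp add: count_mset count_list_eq_length_filter length_filter_conv_card eq_commute)
  also have "\<dots> \<le> d" using assms V by (auto simp: \<W> permutations_of_multiset_def count_uniform_mset)
  finally show ?thesis .
qed

lemma words_swap: "w \<in> \<W> \<Longrightarrow> p < L \<Longrightarrow> q < L \<Longrightarrow> swap_word p q w \<in> \<W>"
  using words_length[of w] mset_swap_word[of p w q] by (simp add: \<W> permutations_of_multiset_def)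

lemma words_defects_swap:
  assumes "w \<in> \<W>" "p < L" "q < L"
  shows "defects L (nth (swap_word p q w)) = defects L (nth w \<circ> Transposition.transpose p q)"
    "loops L (nth (swap_word p q w)) = loops L (nth w \<circ> Transposition.transpose p q)"
  using assms words_length[OF assms(1)] L(2) nth_swap_word[of p w q]
  by (auto intro!: defects_cong loops_cong)

text \<open>For fixed \<open>p\<close> and \<open>q\<close> the swap is an involution on the words,
  so a uniform word stays uniform. The mean size of \<open>G\<close> can thus be computed after a
  swap with a random \<open>q\<close>.\<close>

lemma sum_over_swaps:
  fixes G :: "'a list \<Rightarrow> nat set"
  assumes "\<And>w. w \<in> \<W> \<Longrightarrow> G w \<subseteq> {..<L}"
  shows "L * (\<Sum>w\<in>\<W>. card (G w)) = (\<Sum>w\<in>\<W>. \<Sum>p<L. card {q. q < L \<and> p \<in> G (swap_word p q w)})"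
proof -
  have inv: "(\<Sum>w\<in>\<W>. of_bool (p \<in> G (swap_word p q w))) = (\<Sum>w\<in>\<W>. of_bool (p \<in> G w) :: nat)"
    if "p < L" "q < L" for p q
  proof (rule sum.reindex_bij_witness[of _ "swap_word p q" "swap_word p q"])
    show "swap_word p q (swap_word p q w) = w" if "w \<in> \<W>" for w
      using swap_word_swap_word[of p w q] words_length[OF that] \<open>p < L\<close> \<open>q < L\<close> by simp
    then show "swap_word p q (swap_word p q w) = w" if "w \<in> \<W>" for w using that .
  qed (use that words_swap in auto)
  have "(\<Sum>w\<in>\<W>. \<Sum>p<L. card {q. q < L \<and> p \<in> G (swap_word p q w)})
      = (\<Sum>w\<in>\<W>. \<Sum>p<L. \<Sum>q<L. of_bool (p \<in> G (swap_word p q w)))"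
    by (simp add: Collect_conj_eq lessThan_def)
  also have "\<dots> = (\<Sum>p<L. \<Sum>q<L. \<Sum>w\<in>\<W>. of_bool (p \<in> G (swap_word p q w)))"
    by (subst sum.swap, rule sum.cong[OF refl], subst sum.swap) simp
  also have "\<dots> = (\<Sum>p<L. \<Sum>q<L. \<Sum>w\<in>\<W>. of_bool (p \<in> G w))"
    by (rule sum.cong[OF refl], rule sum.cong[OF refl], rule inv) auto
  also have "\<dots> = L * (\<Sum>p<L. \<Sum>w\<in>\<W>. of_bool (p \<in> G w))" by (simp add: sum_distrib_left)
  also have "\<dots> = L * (\<Sum>w\<in>\<W>. \<Sum>p<L. of_bool (p \<in> G w))" by (subst sum.swap) simp
  also have "\<dots> = L * (\<Sum>w\<in>\<W>. card (G w))"
    using assms by (intro arg_cong[of _ _ "\<lambda>x. L * x"] sum.cong refl) (simp add: Int_absorb1)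
  finally show ?thesis by simp
qed

text \<open>For each word and each \<open>p\<close>, at most \<open>d + 2\<close> of the
  \<open>L\<close> choices of \<open>q\<close> leave a loop at \<open>p\<close>; summing over
  \<open>p\<close> bounds the mean.\<close>

lemma sum_loops: assumes "L > 0" shows "(\<Sum>w\<in>\<W>. card (loops L (nth w))) \<le> card \<W> * (d + 2)"
proof -
  have "L * (\<Sum>w\<in>\<W>. card (loops L (nth w)))
      = (\<Sum>w\<in>\<W>. \<Sum>p<L. card {q. q < L \<and> p \<in> loops L (nth (swap_word p q w))})"
    by (rule sum_over_swaps) (auto simp: loops_def)
  also have "\<dots> \<le> (\<Sum>w\<in>\<W>. \<Sum>p<L. d + 2)"
  proof (intro sum_mono)
    fix w p assume w: "w \<in> \<W>" "p \<in> {..<L}"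
    have "{q. q < L \<and> p \<in> loops L (nth (swap_word p q w))} = {q. q < L \<and> p \<in> loops L (nth w \<circ> Transposition.transpose p q)}"
      using words_defects_swap(2)[OF w(1)] w(2) by auto
    then show "card {q. q < L \<and> p \<in> loops L (nth (swap_word p q w))} \<le> d + 2"
      using card_loop_creating[OF L(2), of "nth w" d p] words_occ[OF w(1)] by simp
  qed
  also have "\<dots> = L * (card \<W> * (d + 2))" by (simp add: algebra_simps)
  finally show ?thesis using assms by (simp only: mult_le_cancel1)
qed

text \<open>The conditional terms of \<open>card_defect_creating\<close> add up to the squared
  number of loops, at most \<open>L\<close> times that number, and the mean of the latter is bounded
  by \<open>sum_loops\<close>.\<close>

lemma sum_defects:
  assumes "L > 0" shows "(\<Sum>w\<in>\<W>. card (defects L (nth w))) \<le> card \<W> * (d * d + 3 * d + 4)"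
proof -
  let ?l = "\<lambda>w. card (loops L (nth w))"
  have "L * (\<Sum>w\<in>\<W>. card (defects L (nth w)))
      = (\<Sum>w\<in>\<W>. \<Sum>p<L. card {q. q < L \<and> p \<in> defects L (nth (swap_word p q w))})"
    by (rule sum_over_swaps) (auto simp: defects_def)
  also have "\<dots> \<le> (\<Sum>w\<in>\<W>. \<Sum>p<L. d * d + 2 * d + 2 + (if p \<in> loops L (nth w) then ?l w else 0))"
  proof (intro sum_mono)
    fix w p assume w: "w \<in> \<W>" "p \<in> {..<L}"
    have "{q. q < L \<and> p \<in> defects L (nth (swap_word p q w))} = {q. q < L \<and> p \<in> defects L (nth w \<circ> Transposition.transpose p q)}"
      using words_defects_swap(1)[OF w(1)] w(2) by auto
    then show "card {q. q < L \<and> p \<in> defects L (nth (swap_word p q w))}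
        \<le> d * d + 2 * d + 2 + (if p \<in> loops L (nth w) then ?l w else 0)"
      using card_defect_creating[OF L(2), of "nth w" d p] words_occ[OF w(1)] w(2) by simp
  qed
  also have "\<dots> \<le> (\<Sum>w\<in>\<W>. L * (d * d + 2 * d + 2) + L * ?l w)"
  proof (rule sum_mono)
    fix w assume "w \<in> \<W>"
    have sub: "loops L (nth w) \<subseteq> {..<L}" by (auto simp: loops_def)
    have "(\<Sum>p<L. if p \<in> loops L (nth w) then ?l w else 0) = (\<Sum>p\<in>loops L (nth w). ?l w)"
      using sub by (simp add: sum.inter_restrict[symmetric] Int_absorb1)
    also have "\<dots> = ?l w * ?l w" by simp
    also have "\<dots> \<le> L * ?l w" using card_mono[OF _ sub] by (intro mult_right_mono) auto
    finally show "(\<Sum>p<L. d * d + 2 * d + 2 + (if p \<in> loops L (nth w) then ?l w else 0))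
        \<le> L * (d * d + 2 * d + 2) + L * ?l w" unfolding sum.distrib sum_constant by (simp add: distrib_left)
  qed
  also have "\<dots> = L * (card \<W> * (d * d + 2 * d + 2) + (\<Sum>w\<in>\<W>. ?l w))"
    by (simp add: sum.distrib sum_distrib_left algebra_simps)
  also have "\<dots> \<le> L * (card \<W> * (d * d + 2 * d + 2) + card \<W> * (d + 2))"
    using sum_loops[OF assms] by (intro mult_left_mono add_left_mono) auto
  also have "\<dots> = L * (card \<W> * (d * d + 3 * d + 4))" by (simp add: algebra_simps)
  finally show ?thesis using assms by simp
qed

text \<open>A word with \<open>Suc k\<close> defects is one swap away from a word with at most
  \<open>k\<close>, and there are \<open>L\<^sup>2\<close> swaps to undo.\<close>

lemma few_defects_step:
  assumes big: "L > 2 * (d * d) + 3 * d + 2 + Suc k"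
  shows "card {w\<in>\<W>. card (defects L (nth w)) \<le> Suc k} \<le> L\<^sup>2 * card {w\<in>\<W>. card (defects L (nth w)) \<le> k}"
proof -
  let ?S = "\<lambda>k. {w\<in>\<W>. card (defects L (nth w)) \<le> k}"
  let ?f = "\<lambda>(p, q, w). swap_word p q w"
  have "?S (Suc k) \<subseteq> ?f ` ({..<L} \<times> {..<L} \<times> ?S k)"
  proof
    fix w assume w: "w \<in> ?S (Suc k)"
    then have wW: "w \<in> \<W>" by simp
    show "w \<in> ?f ` ({..<L} \<times> {..<L} \<times> ?S k)"
    proof (cases "card (defects L (nth w)) \<le> k")
      case True
      \<comment> \<open>The trivial swap at position 0 covers words that already have at most
        \<open>k\<close> defects.\<close>
      then show ?thesis using wW big by (intro image_eqI[of _ _ "(0, 0, w)"]) auto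
    next
      case False
      then obtain p where p: "p \<in> defects L (nth w)" by (metis card.empty ex_in_conv le0)
      have "L > 2 * (d * d) + 3 * d + 2 + card (defects L (nth w))" using big w by simp
      then obtain q where q: "q < L" "card (defects L (nth w \<circ> Transposition.transpose p q)) < card (defects L (nth w))"
        using defect_reducing_swap[OF L(2) words_occ[OF wW] p] by blast
      have pL: "p < L" using p by (simp add: defects_def)
      have "swap_word p q w \<in> ?S k"
        using q w words_swap[OF wW pL q(1)] words_defects_swap(1)[OF wW pL q(1)] by simp
      moreover have "w = swap_word p q (swap_word p q w)"
        using swap_word_swap_word[of p w q] words_length[OF wW] pL q(1) by simp
      ultimately show ?thesis using pL q(1) by (intro image_eqI[of _ _ "(p, q, swap_word p q w)"]) auto
    qed
  qed
  then have "card (?S (Suc k)) \<le> card ({..<L} \<times> {..<L} \<times> ?S k)"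
    using words_fin by (intro surj_card_le) auto
  then show ?thesis by (simp add: card_cartesian_product power2_eq_square)
qed

lemma few_defects:
  assumes "L > 2 * (d * d) + 3 * d + 2 + k"
  shows "card {w\<in>\<W>. card (defects L (nth w)) \<le> k} \<le> L ^ (2 * k) * card {w\<in>\<W>. simple_word w}"
  using assms
proof (induction k)
  case 0
  then show ?case using words_fin words_length L(2)
    by (auto intro!: card_mono simple_word_if_no_defects)
next
  case (Suc k)
  have "card {w\<in>\<W>. card (defects L (nth w)) \<le> Suc k} \<le> L\<^sup>2 * card {w\<in>\<W>. card (defects L (nth w)) \<le> k}"
    using Suc.prems by (rule few_defects_step)
  also have "\<dots> \<le> L\<^sup>2 * (L ^ (2 * k) * card {w\<in>\<W>. simple_word w})"
    using Suc by (intro mult_left_mono) auto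
  finally show ?case by (simp add: power_add algebra_simps power2_eq_square)
qed

text \<open>By Markov's inequality at least half of all words have at most \<open>k\<close> defects.\<close>

lemma card_words_le_simple:
  assumes k: "k = 2 * (d * d + 3 * d + 4)" and big: "L > 2 * (d * d) + 3 * d + 2 + k"
  shows "card \<W> \<le> 2 * L ^ (2 * k) * card {w\<in>\<W>. simple_word w}"
proof -
  let ?S = "{w\<in>\<W>. card (defects L (nth w)) \<le> k}"
  have "card (\<W> - ?S) * k = (\<Sum>w\<in>\<W> - ?S. k)" by simp
  also have "\<dots> \<le> (\<Sum>w\<in>\<W> - ?S. card (defects L (nth w)))" by (intro sum_mono) auto
  also have "\<dots> \<le> (\<Sum>w\<in>\<W>. card (defects L (nth w)))" using words_fin by (intro sum_mono2) auto
  also have "\<dots> \<le> card \<W> * (d * d + 3 * d + 4)" using sum_defects big by simp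
  finally have "(2 * card (\<W> - ?S)) * (d * d + 3 * d + 4) \<le> card \<W> * (d * d + 3 * d + 4)"
    unfolding k by (simp add: algebra_simps)
  then have "2 * card (\<W> - ?S) \<le> card \<W>" by (subst (asm) mult_le_cancel2) simp
  moreover have "card (\<W> - ?S) = card \<W> - card ?S" "card ?S \<le> card \<W>"
    using words_fin by (auto intro!: card_Diff_subset card_mono)
  ultimately have "card \<W> \<le> 2 * card ?S" by linarith
  then show ?thesis using few_defects[OF big] by simp
qed

end

section \<open>First moment bound\<close>

lemma ln_le_iff_le_exp: "0 < x \<Longrightarrow> ln x \<le> y \<longleftrightarrow> x \<le> exp (y :: real)"
  by (metis exp_le_cancel_iff exp_ln)

text \<open>The single term \<open>n ^ n / fact n\<close> of the series of \<open>exp n\<close> is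
  at most the whole sum.\<close>

lemma ln_fact_lower: "real n * ln (real n) - real n \<le> ln (fact n)"
proof (cases "n = 0")
  case False
  have "real n ^ n /\<^sub>R fact n \<le> (\<Sum>k. real n ^ k /\<^sub>R fact k)"
    using sum_le_suminf[OF summable_exp_generic, of "{n}" "real n"] by simp
  then have "real n ^ n / fact n \<le> exp (real n)" by (simp add: exp_def field_simps)
  then have "ln (real n ^ n / fact n) \<le> real n" using False by (subst ln_le_iff_le_exp) auto
  then show ?thesis using False by (simp add: ln_div ln_realpow)
qed simp

text \<open>The induction step amounts to
  \<open>(n + 1) * ln (n / (n + 1)) \<le> -1\<close>.\<close>

lemma ln_fact_upper:
  assumes "n > 0" shows "ln (fact n) \<le> 1 + ln (real n) + (real n * ln (real n) - real n)"
  using assms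
proof (induction n rule: nat_induct_non_zero)
  case (Suc n)
  have "real n / (real n + 1) \<le> exp (- 1 / (real n + 1))"
    using exp_ge_add_one_self[of "- 1 / (real n + 1)"] by (simp add: field_simps)
  then have "ln (real n / (real n + 1)) \<le> - 1 / (real n + 1)"
    using Suc(1) by (subst ln_le_iff_le_exp) auto
  then have "ln (real n) - ln (real n + 1) \<le> - 1 / (real n + 1)" using Suc(1) by (simp add: ln_div)
  then have "(real n + 1) * (ln (real n) - ln (real n + 1)) \<le> (real n + 1) * (- 1 / (real n + 1))"
    by (intro mult_left_mono) auto
  then have key: "(real n + 1) * ln (real n) + 1 \<le> (real n + 1) * ln (real n + 1)"
    by (simp add: algebra_simps)
  have "ln (fact (Suc n)) = ln (real n + 1) + ln (fact n)"
    by (simp add: ln_mult add.commute)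
  also have "\<dots> \<le> ln (real n + 1) + (1 + ln (real n) + (real n * ln (real n) - real n))"
    using Suc by simp
  finally show ?case using key by (simp add: algebra_simps)
qed simp

section \<open>Union bound over all cuts\<close>

definition cut_pairs :: "'a set \<Rightarrow> nat \<Rightarrow> ('a set \<times> 'a set) set" where
  "cut_pairs V s = (SIGMA A:{A. A \<subseteq> V \<and> card A = s}. {C. C \<subseteq> V - A \<and> card C = s})"

lemma card_cut_pairs:
  assumes V: "finite V" and s: "2 * s \<le> card V"
  shows "finite (cut_pairs V s)"
    "real (card (cut_pairs V s)) = fact (card V) / (fact s ^ 2 * fact (card V - 2 * s))"
proof -
  have fin: "finite {A. A \<subseteq> V \<and> card A = s}" using V by simp
  have c: "card {C. C \<subseteq> V - A \<and> card C = s} = (card V - s) choose s" if "A \<subseteq> V" "card A = s" for A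
  proof -
    have "card (V - A) = card V - s" using that V by (metis card_Diff_subset finite_subset)
    then show ?thesis using V by (simp add: n_subsets)
  qed
  show "finite (cut_pairs V s)" unfolding cut_pairs_def using V by auto
  have "card (cut_pairs V s) = (\<Sum>A\<in>{A. A \<subseteq> V \<and> card A = s}. card {C. C \<subseteq> V - A \<and> card C = s})"
    unfolding cut_pairs_def using V by (intro card_SigmaI) auto
  also have "\<dots> = (card V choose s) * ((card V - s) choose s)" using c V by (simp add: n_subsets)
  finally show "real (card (cut_pairs V s)) = fact (card V) / (fact s ^ 2 * fact (card V - 2 * s))"
    using s by (simp add: binomial_fact power2_eq_square) (simp add: mult_2)
qed

text \<open>The number of pairs \<open>(A, C)\<close> times the bound of
  \<open>card_avoiding_words\<close> on the proportion of words avoiding a given pair; the powers of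
  \<open>fact d\<close> cancel.\<close>

definition cut_bound :: "nat \<Rightarrow> real \<Rightarrow> real \<Rightarrow> nat \<Rightarrow> nat \<Rightarrow> real" where
  "cut_bound d u w n s = fact n / (fact s ^ 2 * fact (n - 2 * s))
     * (fact (d * s) ^ 2 * fact (d * (n - 2 * s))) / fact (d * n)
     / (u ^ (2 * d * s) * w ^ (d * (n - 2 * s)))"

definition cut_graphs :: "nat \<Rightarrow> nat \<Rightarrow> nat \<Rightarrow> nat set set set" where
  "cut_graphs n d s = {E \<in> regular_graphs n d. \<exists>(A, C)\<in>cut_pairs {..<n} s. \<forall>a\<in>A. \<forall>c\<in>C. {a, c} \<notin> E}"

text \<open>Graphs are replaced by their simple words, a union bound over the cuts is taken among
  all words, and passing back to simple words costs a polynomial factor.\<close>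

lemma card_cut_graphs:
  fixes u w :: real
  assumes d: "d > 0" and ev: "even (d * n)" and s: "2 * s \<le> n"
    and uw: "u > 0" "w > 0" "2 * u\<^sup>2 + 4 * (u * w) + w\<^sup>2 = 1"
    and k: "k = 2 * (d * d + 3 * d + 4)" and big: "d * n > 2 * (d * d) + 3 * d + 2 + k"
  shows "real (card (cut_graphs n d s))
      \<le> 2 * real (d * n) ^ (2 * k) * cut_bound d u w n s * real (card (regular_graphs n d))"
    and "regular_graphs n d \<noteq> {}"
proof -
  define W where "W = permutations_of_multiset (uniform_mset d {..<n})"
  define K where "K = (fact (d * n div 2) * 2 ^ (d * n div 2) :: nat)"
  define S where "S = {w \<in> W. simple_word w}"
  have "S = {w \<in> W. simple_word w \<and> set (edge_list w) \<in> regular_graphs n d}"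
    using simple_word_regular unfolding S_def W_def permutations_of_multiset_def by blast
  then have S: "card S = card (regular_graphs n d) * K"
    unfolding W_def K_def using card_simple_words[of "regular_graphs n d" n d] by simp
  have W: "card W \<le> 2 * (d * n) ^ (2 * k) * card S"
    unfolding S_def by (rule card_words_le_simple[of "{..<n}"]) (use ev k big in \<open>auto simp: W_def\<close>)
  have cW: "real (card W) * fact d ^ n = fact (d * n)"
  proof -
    have "card W * fact d ^ card {..<n} = fact (d * card {..<n})"
      unfolding W_def by (rule card_words) (use d in auto)
    then have "real (card W * fact d ^ n) = real (fact (d * n))" by simp
    then show ?thesis by simp
  qed
  have Wpos: "card W > 0" using cW by (metis fact_nonzero mult_eq_0_iff neq0_conv of_nat_0)
  \<comment> \<open>Existence of a \<open>d\<close>-regular graph comes for free, since words exist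
    and simple ones are a positive fraction of them.\<close>
  then have "card S \<noteq> 0" using W by (metis less_le_trans mult_0_right not_less0)
  then show ne: "regular_graphs n d \<noteq> {}" using S by auto
  define Y where "Y = u ^ (2 * d * s) * w ^ (d * (n - 2 * s))"
  have Y: "Y > 0" using uw by (simp add: Y_def)
  define F where "F = (fact (d * s) ^ 2 * fact (d * (n - 2 * s)) :: real)"
  have sub: "{w \<in> W. simple_word w \<and> set (edge_list w) \<in> cut_graphs n d s}
      \<subseteq> (\<Union>(A, C)\<in>cut_pairs {..<n} s. avoiding_words d {..<n} A C)"
  proof
    fix ws assume ws: "ws \<in> {w \<in> W. simple_word w \<and> set (edge_list w) \<in> cut_graphs n d s}"
    then obtain A C where AC: "(A, C) \<in> cut_pairs {..<n} s" "\<And>a c. a \<in> A \<Longrightarrow> c \<in> C \<Longrightarrow> {a, c} \<notin> set (edge_list ws)"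
      unfolding cut_graphs_def by blast
    have "\<not> (a \<in> A \<and> b \<in> C) \<and> \<not> (a \<in> C \<and> b \<in> A)" if "(a, b) \<in> set (pairs ws)" for a b
    proof -
      have "{a, b} \<in> set (edge_list ws)" using that by (force simp: edge_list_def)
      then show ?thesis using AC(2)[of a b] AC(2)[of b a] by (auto simp: insert_commute)
    qed
    then have "ws \<in> avoiding_words d {..<n} A C" using ws unfolding avoiding_words_def W_def by blast
    then show "ws \<in> (\<Union>(A, C)\<in>cut_pairs {..<n} s. avoiding_words d {..<n} A C)" using AC(1) by blast
  qed
  have fin: "finite (cut_pairs {..<n} s)" using card_cut_pairs(1)[of "{..<n}" s] s by simp
  have av: "real (card (avoiding_words d {..<n} A C)) \<le> F / (fact d ^ n * Y)" if "(A, C) \<in> cut_pairs {..<n} s" for A C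
  proof -
    have AC: "A \<subseteq> {..<n}" "C \<subseteq> {..<n}" "A \<inter> C = {}" "card A = s" "card C = s"
      using that unfolding cut_pairs_def by auto
    have "real (card (avoiding_words d {..<n} A C)) * fact d ^ n * Y \<le> F"
      using card_avoiding_words[of "{..<n}" d A C s u w] AC d ev uw unfolding Y_def F_def by simp
    then show ?thesis using Y by (simp add: field_simps)
  qed
  have "real (card (cut_graphs n d s) * K) = real (card {w \<in> W. simple_word w \<and> set (edge_list w) \<in> cut_graphs n d s})"
    unfolding W_def K_def by (subst card_simple_words) (auto simp: cut_graphs_def)
  also have "\<dots> \<le> real (card (\<Union>(A, C)\<in>cut_pairs {..<n} s. avoiding_words d {..<n} A C))"
    using fin by (intro of_nat_mono card_mono sub) (auto simp: avoiding_words_def)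
  also have "\<dots> \<le> (\<Sum>(A, C)\<in>cut_pairs {..<n} s. real (card (avoiding_words d {..<n} A C)))"
    using card_UN_le[OF fin, of "\<lambda>(A, C). avoiding_words d {..<n} A C"]
    by (simp add: case_prod_beta flip: of_nat_sum)
  also have "\<dots> \<le> (\<Sum>p\<in>cut_pairs {..<n} s. F / (fact d ^ n * Y))"
    using av by (intro sum_mono) auto
  also have "\<dots> = real (card (cut_pairs {..<n} s)) * F / Y / fact d ^ n" by simp
  also have "\<dots> = cut_bound d u w n s * (fact (d * n) / fact d ^ n)"
    unfolding cut_bound_def Y_def[symmetric] F_def[symmetric] using s
    by (simp add: card_cut_pairs)
  also have "fact (d * n) / fact d ^ n = real (card W)" using cW by (simp add: field_simps)
  \<comment> \<open>Here all words are compared with the simple ones; the common fibre size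
    \<open>K\<close> is then cancelled.\<close>
  also have "cut_bound d u w n s * real (card W)
      \<le> cut_bound d u w n s * real (2 * (d * n) ^ (2 * k) * card S)"
    using W uw by (intro mult_left_mono of_nat_mono) (auto simp: cut_bound_def)
  also have "\<dots> = (2 * real (d * n) ^ (2 * k) * cut_bound d u w n s * real (card (regular_graphs n d))) * real K"
    by (simp add: S)
  finally have "real (card (cut_graphs n d s)) * real K
      \<le> (2 * real (d * n) ^ (2 * k) * cut_bound d u w n s * real (card (regular_graphs n d))) * real K" by simp
  moreover have "real K > 0" by (simp add: K_def)
  ultimately show "real (card (cut_graphs n d s))
      \<le> 2 * real (d * n) ^ (2 * k) * cut_bound d u w n s * real (card (regular_graphs n d))"
    by (simp only: mult_le_cancel_right_pos)
qed

section \<open>Exponential decay and the limit\<close>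

definition cut_exponent :: "nat \<Rightarrow> real \<Rightarrow> real \<Rightarrow> real \<Rightarrow> real" where
  "cut_exponent d u w \<alpha> = (real d - 1) * (2 * \<alpha> * ln \<alpha> + (1 - 2 * \<alpha>) * ln (1 - 2 * \<alpha>))
     - real d * (2 * \<alpha> * ln u + (1 - 2 * \<alpha>) * ln w)"

lemma cut_bound_le:
  assumes d: "d > 0" and s: "s > 0" "2 * s < n" and uw: "u > 0" "w > 0"
  shows "cut_bound d u w n s \<le> exp 4 * real (d * n) ^ 4 * exp (real n * cut_exponent d u w (real s / real n))"
proof -
  define r where "r = n - 2 * s"
  have n: "n > 0" "r > 0" "real r = real n - 2 * real s" using s by (auto simp: r_def)
  have mulln: "real (d * m) * ln (real (d * m)) = real d * real m * ln (real d) + real d * (real m * ln (real m))"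
    if "m > 0" for m using that d by (simp add: ln_mult algebra_simps)
  have lnle: "ln (real (d * m)) \<le> ln (real (d * n))" if "m > 0" "m \<le> n" for m
    using that d by (subst ln_le_cancel_iff) auto
  have ln_n: "ln (real n) \<le> ln (real (d * n))" using n d by (subst ln_le_cancel_iff) auto
  have pos: "cut_bound d u w n s > 0" using uw by (simp add: cut_bound_def)
  have "ln (cut_bound d u w n s) = ln (fact n) - (2 * ln (fact s) + ln (fact r))
      + (2 * ln (fact (d * s)) + ln (fact (d * r))) - ln (fact (d * n))
      - (real (2 * d * s) * ln u + real (d * r) * ln w)"
    unfolding cut_bound_def r_def[symmetric] using uw
    by (simp add: ln_div ln_mult ln_realpow)
  also have "\<dots> \<le> (1 + ln (real n) + (real n * ln (real n) - real n))
     - (2 * (real s * ln (real s) - real s) + (real r * ln (real r) - real r))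
     + (2 * (1 + ln (real (d * s)) + (real (d * s) * ln (real (d * s)) - real (d * s)))
        + (1 + ln (real (d * r)) + (real (d * r) * ln (real (d * r)) - real (d * r))))
     - (real (d * n) * ln (real (d * n)) - real (d * n))
     - (real (2 * d * s) * ln u + real (d * r) * ln w)"
    using n s d by (intro diff_mono add_mono mult_left_mono ln_fact_upper ln_fact_lower order_refl) auto
  \<comment> \<open>The terms linear in the arguments and those with \<open>ln (real d)\<close>
    cancel because \<open>2 * s + r = n\<close>. The four factorials estimated from above leave the
    error \<open>4 + 4 * ln (real (d * n))\<close>.\<close>
  also have "\<dots> \<le> 4 + 4 * ln (real (d * n))
     + ((real d - 1) * (2 * (real s * ln (real s)) + real r * ln (real r) - real n * ln (real n))
        - real d * (2 * real s * ln u + real r * ln w))"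
    using lnle[of s] lnle[of r] ln_n s n unfolding mulln[OF s(1)] mulln[OF n(1)] mulln[OF n(2)]
    by (simp add: r_def[symmetric]) (simp add: n(3) algebra_simps)
  also have "(real d - 1) * (2 * (real s * ln (real s)) + real r * ln (real r) - real n * ln (real n))
        - real d * (2 * real s * ln u + real r * ln w) = real n * cut_exponent d u w (real s / real n)"
  proof -
    define \<alpha> where "\<alpha> = real s / real n"
    have r: "1 - 2 * \<alpha> = real r / real n" using n by (simp add: \<alpha>_def diff_divide_distrib)
    have a: "real n * \<alpha> = real s" "real n * (1 - 2 * \<alpha>) = real r" unfolding r using n by (auto simp: \<alpha>_def)
    have lns: "ln \<alpha> = ln (real s) - ln (real n)" "ln (1 - 2 * \<alpha>) = ln (real r) - ln (real n)"
      unfolding r unfolding \<alpha>_def using n(1,2) s(1) by (simp_all add: ln_div)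
    have "real n * cut_exponent d u w \<alpha>
      = (real d - 1) * (2 * (real n * \<alpha>) * ln \<alpha> + (real n * (1 - 2 * \<alpha>)) * ln (1 - 2 * \<alpha>))
        - real d * (2 * (real n * \<alpha>) * ln u + (real n * (1 - 2 * \<alpha>)) * ln w)"
      unfolding cut_exponent_def by (simp add: algebra_simps)
    also have "\<dots> = (real d - 1) * (2 * real s * (ln (real s) - ln (real n)) + real r * (ln (real r) - ln (real n)))
        - real d * (2 * real s * ln u + real r * ln w)"
      unfolding a lns ..
    also have "2 * real s * (ln (real s) - ln (real n)) + real r * (ln (real r) - ln (real n))
       = 2 * (real s * ln (real s)) + real r * ln (real r) - real n * ln (real n)"
      by (simp add: n(3) algebra_simps)
    finally show ?thesis by (simp add: \<alpha>_def)
  qed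
  finally have "cut_bound d u w n s \<le> exp (4 + 4 * ln (real (d * n)) + real n * cut_exponent d u w (real s / real n))"
    using pos by (subst (asm) ln_le_iff_le_exp) auto
  also have "exp (4 * ln (real (d * n))) = real (d * n) ^ 4"
    using n d exp_of_nat_mult[of 4 "ln (real (d * n))"] by simp
  then have "exp (4 + 4 * ln (real (d * n)) + real n * cut_exponent d u w (real s / real n))
     = exp 4 * real (d * n) ^ 4 * exp (real n * cut_exponent d u w (real s / real n))"
    by (simp only: exp_add)
  finally show ?thesis .
qed

text \<open>With the size \<open>s n\<close> near \<open>(1 - xpar t) / 2 * n\<close>, the exponent
  of \<open>cut_bound\<close> tends to \<open>rate d t < 0\<close>, and the exponential decay beats
  the polynomial factors.\<close>

lemma aas_regular_if_bad_subset_cut_graphs: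
  assumes d: "d \<ge> 3" and t: "t > 0" and neg: "rate d t < 0"
    and bad: "\<And>n E. E \<in> regular_graphs n d \<Longrightarrow> \<not> P n E \<Longrightarrow> E \<in> cut_graphs n d (nat \<lfloor>(1 - xpar t) / 2 * real n\<rfloor>)"
  shows "aas_regular d P"
proof -
  define x where "x = xpar t"
  define a where "a = (1 - x) / 2"
  define s where "s n = nat \<lfloor>a * real n\<rfloor>" for n
  define k where "k = 2 * (d * d + 3 * d + 4)"
  \<comment> \<open>With \<open>u = t * w\<close> the normalisation reads
    \<open>den t * w\<^sup>2 = 1\<close>, which fixes \<open>w\<close>.\<close>
  define w where "w = 1 / sqrt (den t)"
  define u where "u = t * w"
  define B where "B n = 2 * real (d * n) ^ (2 * k) * cut_bound d u w n (s n)" for n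
  note x = xpar_bounds[OF t, folded x_def] and D = den_pos[OF t]
  have a: "0 < a" "2 * a < 1" using x by (auto simp: a_def)
  have w: "w > 0" "w\<^sup>2 = 1 / den t" "ln w = - ln (den t) / 2"
    using D by (auto simp: w_def power_divide ln_div ln_sqrt)
  have u: "u > 0" "ln u = ln t - ln (den t) / 2" using w t by (auto simp: u_def ln_mult)
  have "2 * u\<^sup>2 + 4 * (u * w) + w\<^sup>2 = den t * w\<^sup>2" by (simp add: u_def den_def power2_eq_square algebra_simps)
  then have uw: "2 * u\<^sup>2 + 4 * (u * w) + w\<^sup>2 = 1" using w(2) D by simp
  have sle: "real (s n) \<le> a * real n" for n using a by (simp add: s_def of_nat_floor)
  have s2: "2 * s n < n" if "n > 0" for n
  proof -
    have "real (s n) \<le> a * real n" using sle .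
    moreover have "2 * a * real n < real n" using a that by simp
    ultimately show ?thesis by linarith
  qed
  have "(\<lambda>n. real_of_int \<lfloor>a * real n\<rfloor> / real n) \<longlonglongrightarrow> a" using a by real_asymp
  then have sn: "(\<lambda>n. real (s n) / real n) \<longlonglongrightarrow> a"
    using a by (simp add: s_def)
  have "(\<lambda>n. cut_exponent d u w (real (s n) / real n)) \<longlonglongrightarrow> cut_exponent d u w a"
    unfolding cut_exponent_def using a by (intro tendsto_intros sn) auto
  also have "cut_exponent d u w a = rate d t"
    unfolding cut_exponent_def rate_def x_def[symmetric] u(2) w(3) using x
    by (simp add: a_def field_simps)
  \<comment> \<open>Half of the negative limit leaves room for the convergence of
    \<open>s n / n\<close>.\<close>
  finally have "\<forall>\<^sub>F n in sequentially. cut_exponent d u w (real (s n) / real n) < rate d t / 2"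
    using neg by (intro order_tendstoD) auto
  moreover have "\<forall>\<^sub>F n in sequentially. s n > 0"
  proof -
    have "\<forall>\<^sub>F n in sequentially. real n > 1 / a" by real_asymp
    then show ?thesis by eventually_elim (use a in \<open>auto simp: s_def field_simps\<close>)
  qed
  ultimately have Ble: "\<forall>\<^sub>F n in sequentially. B n \<le> 2 * exp 4 * real d ^ (2 * k + 4) * (real n ^ (2 * k + 4) * exp (rate d t / 2 * real n))"
    using eventually_gt_at_top[of 0]
  proof eventually_elim
    case (elim n)
    have "B n \<le> 2 * real (d * n) ^ (2 * k) * (exp 4 * real (d * n) ^ 4 * exp (real n * cut_exponent d u w (real (s n) / real n)))"
      unfolding B_def using elim d u w s2[of n] by (intro mult_left_mono cut_bound_le) auto
    also have "\<dots> \<le> 2 * real (d * n) ^ (2 * k) * (exp 4 * real (d * n) ^ 4 * exp (real n * (rate d t / 2)))"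
      using elim by (intro mult_left_mono) auto
    also have "\<dots> = 2 * exp 4 * real d ^ (2 * k + 4) * (real n ^ (2 * k + 4) * exp (rate d t / 2 * real n))"
      by (simp add: power_add power_mult_distrib algebra_simps)
    finally show ?case .
  qed
  have "(\<lambda>n. real n ^ (2 * k + 4) * exp (rate d t / 2 * real n)) \<longlonglongrightarrow> 0"
    using neg by real_asymp
  then have lim: "(\<lambda>n. 2 * exp 4 * real d ^ (2 * k + 4) * (real n ^ (2 * k + 4) * exp (rate d t / 2 * real n))) \<longlonglongrightarrow> 0"
    by (rule tendsto_mult_right_zero)
  define C where "C n = 2 * exp 4 * real d ^ (2 * k + 4) * (real n ^ (2 * k + 4) * exp (rate d t / 2 * real n))" for n
  let ?F = "inf sequentially (principal {n. even (d * n)})"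
  have "\<forall>\<^sub>F n in sequentially. n > 2 * (d * d) + 3 * d + 2 + k" by (rule eventually_gt_at_top)
  with Ble have "\<forall>\<^sub>F n in sequentially. even (d * n) \<longrightarrow> 1 - C n \<le> measure_pmf.prob (random_regular_graph n d) {E. P n E}"
  proof eventually_elim
    case (elim n)
    show ?case
    proof
      assume ev: "even (d * n)"
      let ?R = "regular_graphs n d"
      have "n \<le> d * n" using d by simp
      then have big: "d * n > 2 * (d * d) + 3 * d + 2 + k" using elim by linarith
      have s2': "2 * s n \<le> n" using s2[of n] elim(2) by simp
      have d0: "d > 0" using d by simp
      note cg = card_cut_graphs[OF d0 ev s2' u(1) w(1) uw k_def big]
      have fin: "finite ?R" by (rule finite_regular_graphs)
      have R0: "real (card ?R) > 0" using cg(2) fin by (simp add: card_gt_0_iff)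
      have "?R - {E. P n E} \<subseteq> cut_graphs n d (s n)"
        using bad unfolding s_def a_def x_def by blast
      then have "card (?R - {E. P n E}) \<le> card (cut_graphs n d (s n))"
        using fin by (intro card_mono) (auto simp: cut_graphs_def)
      then have "real (card (?R - {E. P n E})) \<le> B n * real (card ?R)"
        using cg(1) unfolding B_def by linarith
      also have "\<dots> \<le> C n * real (card ?R)" using elim(1) unfolding C_def by (intro mult_right_mono) auto
      finally have "real (card (?R - {E. P n E})) \<le> C n * real (card ?R)" .
      moreover have "card ?R = card (?R \<inter> {E. P n E}) + card (?R - {E. P n E})"
        using fin by (rule card_Int_Diff)
      ultimately have "(1 - C n) * real (card ?R) \<le> real (card (?R \<inter> {E. P n E}))"
        by (simp add: algebra_simps)
      then have "1 - C n \<le> real (card (?R \<inter> {E. P n E})) / real (card ?R)"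
        using R0 by (simp add: field_simps)
      then show "1 - C n \<le> measure_pmf.prob (random_regular_graph n d) {E. P n E}"
        unfolding random_regular_graph_def using cg(2) fin by (simp add: measure_pmf_of_set)
    qed
  qed
  then have lower: "\<forall>\<^sub>F n in ?F. 1 - C n \<le> measure_pmf.prob (random_regular_graph n d) {E. P n E}"
    by (simp add: eventually_inf_principal)
  have "(\<lambda>n. 1 - C n) \<longlonglongrightarrow> 1 - 0" unfolding C_def by (intro tendsto_intros lim)
  then have "((\<lambda>n. 1 - C n) \<longlongrightarrow> 1) ?F" by (intro tendsto_mono[OF inf_le1]) simp
  then show ?thesis unfolding aas_regular_def
    using lower by (rule tendsto_sandwich[OF _ _ _ tendsto_const, rotated 2]) auto
qed

theorem theorem1p5:
  fixes d :: nat and \<epsilon> :: real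
  assumes "d \<ge> 3" and "\<epsilon> > 0"
  shows "(\<forall>x. 0 < x \<and> x < 1 \<longrightarrow>
            is_arg_max (g d x) (\<lambda>z. 0 < z \<and> z < 1 / 2 \<and> z * x < (1 - x) / 2) (z0 x))
       \<and> (\<exists>!x. 0 < x \<and> x < 1 \<and> h d x = 0)
       \<and> aas_regular d
            (\<lambda>n E. real (hopping_number {..<n} E) > (x_root d - \<epsilon>) * real n)"
proof (intro conjI)
  show "\<forall>x. 0 < x \<and> x < 1 \<longrightarrow>
      is_arg_max (g d x) (\<lambda>z. 0 < z \<and> z < 1 / 2 \<and> z * x < (1 - x) / 2) (z0 x)"
    using is_arg_max_z0 by blast
  show "\<exists>!x. 0 < x \<and> x < 1 \<and> h d x = 0" by (rule h_root_unique(1)[OF assms(1)])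
  \<comment> \<open>The minimum keeps \<open>x\<close> positive for large \<open>\<epsilon>\<close>,
    while \<open>x\<close> stays strictly below the root and at least
    \<open>x_root d - \<epsilon>\<close>.\<close>
  define x where "x = x_root d - min \<epsilon> (x_root d / 2)"
  have x: "0 < x" "x < x_root d" "x < 1" "x_root d - \<epsilon> \<le> x"
    using h_root_unique(2,3)[OF assms(1)] assms(2) by (auto simp: x_def min_def)
  obtain t where t: "t > 0" "xpar t = x" by (rule xpar_surj[OF x(1,3)])
  show "aas_regular d (\<lambda>n E. real (hopping_number {..<n} E) > (x_root d - \<epsilon>) * real n)"
  proof (rule aas_regular_if_bad_subset_cut_graphs[OF assms(1) t(1)])
    show "rate d t < 0" using h_root_unique(4)[OF assms(1) t(1)] t(2) x(2) by simp
    fix n E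
    define s where "s = nat \<lfloor>(1 - x) / 2 * real n\<rfloor>"
    assume E: "E \<in> regular_graphs n d" and "\<not> real (hopping_number {..<n} E) > (x_root d - \<epsilon>) * real n"
    moreover have "(x_root d - \<epsilon>) * real n \<le> x * real n" using x(4) by (intro mult_right_mono) auto
    ultimately have "real (hopping_number {..<n} E) \<le> x * real n" by linarith
    moreover obtain B where B: "hop_feasible {..<n} E B" "card B = hopping_number {..<n} E"
      using hopping_number_attained[of "{..<n}" E] by blast
    moreover have "real s \<le> (1 - x) / 2 * real n" using x unfolding s_def by (intro of_nat_floor) auto
    \<comment> \<open>The sizes \<open>x * n\<close> and twice \<open>(1 - x) / 2 * n\<close> add up
      to \<open>n\<close>, and rounding \<open>s\<close> down only helps.\<close>
    ultimately have "real (card B) + 2 * real s \<le> real n" by (simp add: field_simps)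
    then have "card B + 2 * s \<le> card {..<n}" by simp
    then obtain A C where "A \<subseteq> {..<n}" "C \<subseteq> {..<n}" "A \<inter> C = {}" "card A = s" "card C = s"
      "\<And>a c. a \<in> A \<Longrightarrow> c \<in> C \<Longrightarrow> {a, c} \<notin> E"
      using hop_feasible_cut[OF B(1)] by blast
    then have "(A, C) \<in> cut_pairs {..<n} s" "\<forall>a\<in>A. \<forall>c\<in>C. {a, c} \<notin> E"
      unfolding cut_pairs_def by auto
    then show "E \<in> cut_graphs n d (nat \<lfloor>(1 - xpar t) / 2 * real n\<rfloor>)"
      using E unfolding cut_graphs_def t(2) s_def[symmetric] by blast
  qed
qed

end
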